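(* There is a countable structure whose degree spectrum is null and co-meagre.
   Context: The degree spectrum of a countable structure $\mathcal{M}$ is the collection of all Turing degrees which compute (the atomic diagram of) an isomorphic copy of $\mathcal{M}$ with universe a subset of $\omega$. A collection of Turing degrees is called null (co-null, meagre, co-meagre) if the set of all $X\in 2^\omega$ whose Turing degree belongs to the collection is null (co-null, meagre, co-meagre) in $2^\omega$, with respect to the uniform (fair-coin) measure and the usual topology. *)

theory Defs
  imports "HOL-Probability.Probability" "HOL-Library.Nat_Bijection"
begin

section \<open>Oracle computability and Turing degrees\<close>

text \<open>
  Kleene's schemes for the partial recursive functions, with one additional initial function:
  the characteristic function of an oracle set. Argument tuples are lists; a program is
  undefined on argument lists of a length it does not expect.
\<close>

datatype oprog =
    Zero
  | Succ
  | Proj nat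
  | Oracle
  | Comp oprog "oprog list"
  | PrimRec oprog oprog
  | Mu oprog

inductive eval :: "nat set \<Rightarrow> oprog \<Rightarrow> nat list \<Rightarrow> nat \<Rightarrow> bool" for A :: "nat set" where
  Zero: "eval A Zero xs 0"
| Succ: "eval A Succ [x] (Suc x)"
| Proj: "i < length xs \<Longrightarrow> eval A (Proj i) xs (xs ! i)"
| Oracle: "eval A Oracle [x] (of_bool (x \<in> A))"
| Comp: "length ys = length gs \<Longrightarrow> \<forall>i<length gs. eval A (gs ! i) xs (ys ! i) \<Longrightarrow>
    eval A f ys z \<Longrightarrow> eval A (Comp f gs) xs z"
| PrimRec_0: "eval A f xs y \<Longrightarrow> eval A (PrimRec f g) (0 # xs) y"
| PrimRec_Suc: "eval A (PrimRec f g) (n # xs) r \<Longrightarrow> eval A g (n # r # xs) y \<Longrightarrow>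
    eval A (PrimRec f g) (Suc n # xs) y"
| Mu: "eval A f (y # xs) 0 \<Longrightarrow> \<forall>z<y. \<exists>v>0. eval A f (z # xs) v \<Longrightarrow> eval A (Mu f) xs y"

inductive_cases eval_ZeroE: "eval A Zero xs y"
inductive_cases eval_SuccE: "eval A Succ xs y"
inductive_cases eval_ProjE: "eval A (Proj i) xs y"
inductive_cases eval_OracleE: "eval A Oracle xs y"
inductive_cases eval_CompE: "eval A (Comp f gs) xs y"
inductive_cases eval_PrimRec0E: "eval A (PrimRec f g) (0 # xs) y"
inductive_cases eval_PrimRecSucE: "eval A (PrimRec f g) (Suc n # xs) y"
inductive_cases eval_MuE: "eval A (Mu f) xs y"

lemma eval_deterministic: "eval A p xs y \<Longrightarrow> eval A p xs y' \<Longrightarrow> y = y'"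
proof (induction arbitrary: y' rule: eval.induct)
  case (Comp ys gs xs f z)
  from Comp.prems obtain ys' where ys': "length ys' = length gs"
      "\<forall>i<length gs. eval A (gs ! i) xs (ys' ! i)" "eval A f ys' y'"
    by (rule eval_CompE)
  have "ys = ys'"
    using Comp ys' by (intro nth_equalityI) auto
  then show ?case
    using Comp.IH ys' by auto
next
  case (PrimRec_Suc f g n xs r y)
  from PrimRec_Suc.prems obtain r' where "eval A (PrimRec f g) (n # xs) r'" "eval A g (n # r' # xs) y'"
    by (rule eval_PrimRecSucE)
  then show ?case
    using PrimRec_Suc.IH by blast
next
  case (Mu f y xs)
  from Mu.prems obtain "eval A f (y' # xs) 0" "\<forall>z<y'. \<exists>v>0. eval A f (z # xs) v"
    by (rule eval_MuE)
  then have "\<not> y' < y" "\<not> y < y'"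
    using Mu.IH by fastforce+
  then show ?case by simp
next
  case Zero
  then show ?case by (rule eval_ZeroE) simp
next
  case Succ
  then show ?case by (rule eval_SuccE) simp
next
  case Proj
  from Proj.prems show ?case by (rule eval_ProjE) simp
next
  case Oracle
  then show ?case by (rule eval_OracleE) simp
next
  case PrimRec_0
  from PrimRec_0.prems show ?case by (rule eval_PrimRec0E) (rule PrimRec_0.IH)
qed

definition recursive_in :: "nat set \<Rightarrow> (nat \<Rightarrow> nat) \<Rightarrow> bool" where
  "recursive_in A F \<longleftrightarrow> (\<exists>p. \<forall>x. eval A p [x] (F x))"

definition turing_le :: "nat set \<Rightarrow> nat set \<Rightarrow> bool" where
  "turing_le B A \<longleftrightarrow> recursive_in A (\<lambda>x. of_bool (x \<in> B))"

definition turing_equiv :: "(nat set \<times> nat set) set" where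
  "turing_equiv = {(A, B). turing_le A B \<and> turing_le B A}"

definition turing_degree :: "nat set \<Rightarrow> nat set set" where
  "turing_degree A = turing_equiv `` {A}"

lemma turing_le_refl: "turing_le A A"
  unfolding turing_le_def recursive_in_def by (blast intro: eval.Oracle)

primrec oracle_subst :: "oprog \<Rightarrow> oprog \<Rightarrow> oprog" where
  "oracle_subst q Zero = Zero"
| "oracle_subst q Succ = Succ"
| "oracle_subst q (Proj i) = Proj i"
| "oracle_subst q Oracle = q"
| "oracle_subst q (Comp f gs) = Comp (oracle_subst q f) (map (oracle_subst q) gs)"
| "oracle_subst q (PrimRec f g) = PrimRec (oracle_subst q f) (oracle_subst q g)"
| "oracle_subst q (Mu f) = Mu (oracle_subst q f)"

lemma eval_oracle_subst:
  assumes q: "\<And>x. eval A q [x] (of_bool (x \<in> B))"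
  shows "eval B p xs y \<Longrightarrow> eval A (oracle_subst q p) xs y"
proof (induction rule: eval.induct)
  case (Comp ys gs xs f z)
  show ?case
    unfolding oracle_subst.simps by (rule eval.Comp[of ys]) (use Comp in auto)
next
  case (PrimRec_Suc f g n xs r y)
  then show ?case
    unfolding oracle_subst.simps by (blast intro: eval.PrimRec_Suc)
next
  case (Mu f y xs)
  show ?case
    unfolding oracle_subst.simps by (rule eval.Mu) (use Mu in auto)
qed (simp_all add: q eval.Zero eval.Succ eval.Proj eval.PrimRec_0)

lemma recursive_in_trans: "recursive_in B F \<Longrightarrow> turing_le B A \<Longrightarrow> recursive_in A F"
  unfolding turing_le_def recursive_in_def using eval_oracle_subst by meson

lemma turing_le_trans: "turing_le C B \<Longrightarrow> turing_le B A \<Longrightarrow> turing_le C A"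
  using recursive_in_trans by (simp add: turing_le_def[of C])

lemma equiv_turing_equiv: "equiv UNIV turing_equiv"
  by (rule equivI)
    (auto simp: turing_equiv_def refl_on_def sym_def trans_def
      intro: turing_le_refl turing_le_trans)


section \<open>First-order structures and their atomic diagrams\<close>

text \<open>
  Symbols are natural numbers; the partial functions give the arity of the symbols which
  belong to the language. Constants are nullary function symbols.
\<close>

record language =
  rels :: "nat \<rightharpoonup> nat"
  funs :: "nat \<rightharpoonup> nat"

definition computable_language :: "language \<Rightarrow> bool" where
  "computable_language L \<longleftrightarrow>
     recursive_in {} (\<lambda>r. case rels L r of None \<Rightarrow> 0 | Some k \<Rightarrow> Suc k) \<and>
     recursive_in {} (\<lambda>f. case funs L f of None \<Rightarrow> 0 | Some k \<Rightarrow> Suc k)"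

text \<open>
  Interpretations are total on all symbols and all lists. Only their values at symbols of the
  language, applied to tuples of the right length over the universe, are ever consulted.
\<close>

record 'a struc =
  universe :: "'a set"
  rel_int :: "nat \<Rightarrow> 'a list \<Rightarrow> bool"
  fun_int :: "nat \<Rightarrow> 'a list \<Rightarrow> 'a"

definition is_struc :: "language \<Rightarrow> 'a struc \<Rightarrow> bool" where
  "is_struc L M \<longleftrightarrow> universe M \<noteq> {} \<and>
     (\<forall>f k xs. funs L f = Some k \<longrightarrow> length xs = k \<longrightarrow> set xs \<subseteq> universe M \<longrightarrow>
        fun_int M f xs \<in> universe M)"

definition struc_iso :: "language \<Rightarrow> 'a struc \<Rightarrow> 'b struc \<Rightarrow> ('a \<Rightarrow> 'b) \<Rightarrow> bool" where
  "struc_iso L M N h \<longleftrightarrow> bij_betw h (universe M) (universe N) \<and>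
     (\<forall>r k xs. rels L r = Some k \<longrightarrow> length xs = k \<longrightarrow> set xs \<subseteq> universe M \<longrightarrow>
        (rel_int M r xs \<longleftrightarrow> rel_int N r (map h xs))) \<and>
     (\<forall>f k xs. funs L f = Some k \<longrightarrow> length xs = k \<longrightarrow> set xs \<subseteq> universe M \<longrightarrow>
        h (fun_int M f xs) = fun_int N f (map h xs))"

definition isomorphic :: "language \<Rightarrow> 'a struc \<Rightarrow> 'b struc \<Rightarrow> bool" where
  "isomorphic L M N \<longleftrightarrow> (\<exists>h. struc_iso L M N h)"

text \<open>The elements of the structure serve as names of themselves in closed terms and sentences.\<close>

datatype 'a cterm = Elem 'a | App nat "'a cterm list"

datatype 'a atom = Equal "'a cterm" "'a cterm" | Rel nat "'a cterm list"

datatype 'a literal = Pos "'a atom" | Neg "'a atom"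

primrec wf_cterm :: "language \<Rightarrow> 'a set \<Rightarrow> 'a cterm \<Rightarrow> bool" where
  "wf_cterm L U (Elem a) \<longleftrightarrow> a \<in> U"
| "wf_cterm L U (App f ts) \<longleftrightarrow> funs L f = Some (length ts) \<and> (\<forall>b\<in>set (map (wf_cterm L U) ts). b)"

primrec wf_atom :: "language \<Rightarrow> 'a set \<Rightarrow> 'a atom \<Rightarrow> bool" where
  "wf_atom L U (Equal s t) \<longleftrightarrow> wf_cterm L U s \<and> wf_cterm L U t"
| "wf_atom L U (Rel r ts) \<longleftrightarrow> rels L r = Some (length ts) \<and> (\<forall>t\<in>set ts. wf_cterm L U t)"

primrec cterm_val :: "'a struc \<Rightarrow> 'a cterm \<Rightarrow> 'a" where
  "cterm_val M (Elem a) = a"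
| "cterm_val M (App f ts) = fun_int M f (map (cterm_val M) ts)"

primrec holds_atom :: "'a struc \<Rightarrow> 'a atom \<Rightarrow> bool" where
  "holds_atom M (Equal s t) \<longleftrightarrow> cterm_val M s = cterm_val M t"
| "holds_atom M (Rel r ts) \<longleftrightarrow> rel_int M r (map (cterm_val M) ts)"

definition diagram :: "language \<Rightarrow> 'a struc \<Rightarrow> 'a literal set" where
  "diagram L M =
     {Pos \<phi> | \<phi>. wf_atom L (universe M) \<phi> \<and> holds_atom M \<phi>} \<union>
     {Neg \<phi> | \<phi>. wf_atom L (universe M) \<phi> \<and> \<not> holds_atom M \<phi>}"

text \<open>Goedel numbering of literals over a structure whose elements are natural numbers.\<close>

primrec cterm_code :: "nat cterm \<Rightarrow> nat" where
  "cterm_code (Elem a) = sum_encode (Inl a)"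
| "cterm_code (App f ts) = sum_encode (Inr (prod_encode (f, list_encode (map cterm_code ts))))"

primrec atom_code :: "nat atom \<Rightarrow> nat" where
  "atom_code (Equal s t) = sum_encode (Inl (prod_encode (cterm_code s, cterm_code t)))"
| "atom_code (Rel r ts) = sum_encode (Inr (prod_encode (r, list_encode (map cterm_code ts))))"

primrec literal_code :: "nat literal \<Rightarrow> nat" where
  "literal_code (Pos \<phi>) = sum_encode (Inl (atom_code \<phi>))"
| "literal_code (Neg \<phi>) = sum_encode (Inr (atom_code \<phi>))"

definition atomic_diagram :: "language \<Rightarrow> nat struc \<Rightarrow> nat set" where
  "atomic_diagram L N = literal_code ` diagram L N"

definition degree_spectrum :: "language \<Rightarrow> 'a struc \<Rightarrow> nat set set set" where
  "degree_spectrum L M =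
     {turing_degree A | A. \<exists>N :: nat struc. is_struc L N \<and> isomorphic L M N \<and>
        turing_le (atomic_diagram L N) A}"


section \<open>Measure and category for collections of Turing degrees\<close>

definition fair_coin_measure :: "(nat \<Rightarrow> bool) measure" where
  "fair_coin_measure = Pi\<^sub>M UNIV (\<lambda>_. measure_pmf (bernoulli_pmf (1/2)))"

definition nowhere_dense :: "'a::topological_space set \<Rightarrow> bool" where
  "nowhere_dense S \<longleftrightarrow> interior (closure S) = {}"

definition meagre :: "'a::topological_space set \<Rightarrow> bool" where
  "meagre S \<longleftrightarrow> (\<exists>C :: nat \<Rightarrow> 'a set. (\<forall>n. nowhere_dense (C n)) \<and> S \<subseteq> (\<Union>n. C n))"

text \<open>
  A point of Cantor space is identified with the set of natural numbers of which it is the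
  characteristic function. The topology on \<open>nat \<Rightarrow> bool\<close> is the type class instance, i.e. the
  product of the discrete topologies.
\<close>

definition reals_of :: "nat set set set \<Rightarrow> (nat \<Rightarrow> bool) set" where
  "reals_of D = {X. turing_degree {n. X n} \<in> D}"

text \<open>The completion makes every subset of a measurable set of measure zero a null set.\<close>

definition null_degrees :: "nat set set set \<Rightarrow> bool" where
  "null_degrees D \<longleftrightarrow> reals_of D \<in> null_sets (completion fair_coin_measure)"

definition comeagre_degrees :: "nat set set set \<Rightarrow> bool" where
  "comeagre_degrees D \<longleftrightarrow> meagre (- reals_of D)"

end

theory Submission
  imports Defs
begin

text \<open>
  Consider infinitely many copies of the tree of finite sequences of numbers, the \<open>n\<close>-th played
  against an opponent, who enumerates a set of bad nodes. The structure is the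
  disjoint union of infinitely many classes for every node that never becomes bad; a class
  displays as labels the node and its ancestors. To build a copy from \<open>X\<close>, start a class at any
  node, and whenever its current node is found to be bad, climb to a kid picked by \<open>X\<close>. This
  succeeds for every sufficiently generic \<open>X\<close>, as long as every node has a kid that is never bad.

  If on the other hand \<open>X\<close> computes a copy, then some program with oracle \<open>X\<close> finds, in each
  tree, the finite path to some node that is never bad. The opponent of that program
  waits until the oracles in a certain clopen set \<open>C\<close> which currently reach a node that is not yet bad
  have a prescribed measure, declares their nodes bad, and repeats. An oracle that responds
  infinitely often follows an infinite path, so it fails. If the program succeeded on a set
  of positive measure, \<open>C\<close> could be chosen to approximate that set so well that most of the
  responding oracles would have to be successful ones. To keep some kid of every node from
  becoming bad, the opponent ignores one kid visited by very few oracles; since the kids of a node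
  are visited by disjoint sets of oracles, such kids exist.
\<close>

section \<open>Closure properties of the recursive functions\<close>

text \<open>Category and measure come apart because the opponent reacts to measure only. Of each
  node it must spare a kid on which little measure is spent, and a generic oracle gets to such a
  kid, since a finite part of it always leaves open the choice at some node on its way. Labels show
  ancestors as well because a copy cannot take back what it displays: a node found bad remains an
  ancestor of everything that the class climbs to, so the display stays true. Aiming an opponent at
  a program involves no circularity. One program has to read all trees, while the number of a tree
  carries program, clopen set and threshold; so the program is given, and a tree with suitable data
  is chosen against it. The constants: let w be the measure of the successful oracles.
  \<open>C\<close> differs from their set by less than w/4, and the opponent waits for about w/4.
  Acting infinitely often would yield failing oracles of measure at least w/4 in \<open>C\<close>.
  Acting finitely often leaves room for w/4, plus at most 3w/8 for guards and rounding, but more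
  than 3w/4 of successful oracles lie in \<open>C\<close>.\<close>

definition pfst :: "nat \<Rightarrow> nat" where "pfst z = fst (prod_decode z)"
definition psnd :: "nat \<Rightarrow> nat" where "psnd z = snd (prod_decode z)"
abbreviation pair :: "nat \<Rightarrow> nat \<Rightarrow> nat" where "pair x y \<equiv> prod_encode (x, y)"

lemma pfst_pair [simp]: "pfst (pair x y) = x" by (simp add: pfst_def)
lemma psnd_pair [simp]: "psnd (pair x y) = y" by (simp add: psnd_def)
lemma pair_pfst_psnd [simp]: "pair (pfst z) (psnd z) = z" by (simp add: pfst_def psnd_def)

text \<open>The schemes act on argument lists, so composition and primitive recursion are handled
  with an explicit arity before everything is passed to unary functions.\<close>

definition rcl :: "nat set \<Rightarrow> nat \<Rightarrow> (nat list \<Rightarrow> nat) \<Rightarrow> bool" where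
  "rcl A k F \<longleftrightarrow> (\<exists>p. \<forall>xs. length xs = k \<longrightarrow> eval A p xs (F xs))"

lemma rcl_proj: "i < k \<Longrightarrow> rcl A k (\<lambda>xs. xs ! i)"
  unfolding rcl_def by (blast intro: eval.Proj)

lemma rcl_cong: "(\<And>xs. length xs = k \<Longrightarrow> F xs = G xs) \<Longrightarrow> rcl A k F \<Longrightarrow> rcl A k G"
  unfolding rcl_def by auto

lemma rcl_zero: "rcl A k (\<lambda>xs. 0)"
  unfolding rcl_def by (blast intro: eval.Zero)

lemma rcl_comp:
  assumes F: "rcl A (length Gs) F" and G: "\<And>G. G \<in> set Gs \<Longrightarrow> rcl A k G"
  shows "rcl A k (\<lambda>xs. F (map (\<lambda>G. G xs) Gs))"
proof -
  obtain p where p: "\<And>xs. length xs = length Gs \<Longrightarrow> eval A p xs (F xs)"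
    using F by (auto simp: rcl_def)
  obtain q where q: "\<And>G xs. G \<in> set Gs \<Longrightarrow> length xs = k \<Longrightarrow> eval A (q G) xs (G xs)"
    using G unfolding rcl_def by metis
  have "eval A (Comp p (map q Gs)) xs (F (map (\<lambda>G. G xs) Gs))" if "length xs = k" for xs
    by (rule eval.Comp[of "map (\<lambda>G. G xs) Gs"]) (use that in \<open>auto intro: p q\<close>)
  then show ?thesis unfolding rcl_def by blast
qed

lemma rcl_comp1: "rcl A 1 F \<Longrightarrow> rcl A k G \<Longrightarrow> rcl A k (\<lambda>xs. F [G xs])"
  using rcl_comp[of A "[G]" F k] by simp

lemma rcl_comp2: "rcl A 2 F \<Longrightarrow> rcl A k G \<Longrightarrow> rcl A k H \<Longrightarrow> rcl A k (\<lambda>xs. F [G xs, H xs])"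
  using rcl_comp[of A "[G, H]" F k] by (auto simp: numeral_2_eq_2)

lemma rcl_Suc: assumes "rcl A k G" shows "rcl A k (\<lambda>xs. Suc (G xs))"
proof -
  have "rcl A 1 (\<lambda>xs. Suc (hd xs))"
    unfolding rcl_def by (auto simp: length_Suc_conv intro!: exI[of _ Succ] eval.Succ)
  from rcl_comp1[OF this assms] show ?thesis by simp
qed

lemma rcl_primrec:
  assumes F: "rcl A k F" and G: "rcl A (Suc (Suc k)) G"
  shows "rcl A (Suc k) (\<lambda>xs. rec_nat (F (tl xs)) (\<lambda>n r. G (n # r # tl xs)) (hd xs))"
proof -
  obtain p where p: "\<And>xs. length xs = k \<Longrightarrow> eval A p xs (F xs)"
    using F by (auto simp: rcl_def)
  obtain q where q: "\<And>xs. length xs = Suc (Suc k) \<Longrightarrow> eval A q xs (G xs)"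
    using G by (auto simp: rcl_def)
  have "eval A (PrimRec p q) (n # xs) (rec_nat (F xs) (\<lambda>n r. G (n # r # xs)) n)"
    if "length xs = k" for n xs
  proof (induction n)
    case 0
    show ?case using p[OF that] by (simp add: eval.PrimRec_0)
  next
    case (Suc n)
    show ?case using eval.PrimRec_Suc[OF Suc q] that by simp
  qed
  then show ?thesis unfolding rcl_def
    by (intro exI[of _ "PrimRec p q"]) (auto simp: length_Suc_conv)
qed

lemma rcl_primrec2:
  assumes "rcl A 1 F" "rcl A 3 G" "rcl A k a" "rcl A k b"
  shows "rcl A k (\<lambda>xs. rec_nat (F [a xs]) (\<lambda>n r. G [n, r, a xs]) (b xs))"
  using rcl_comp2[OF _ assms(4,3), of "\<lambda>xs. rec_nat (F (tl xs)) (\<lambda>n r. G (n # r # tl xs)) (hd xs)"]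
    rcl_primrec[of A 1 F G] assms(1,2) by (simp add: numeral_3_eq_3 numeral_2_eq_2)

lemma rcl_add: assumes "rcl A k f" "rcl A k g" shows "rcl A k (\<lambda>xs. f xs + g xs)"
proof -
  have "rec_nat a (\<lambda>n r. Suc r) b = a + b" for a b :: nat by (induction b) auto
  then show ?thesis
    using rcl_primrec2[OF rcl_proj[of 0] rcl_Suc[OF rcl_proj[of 1]] assms] by simp
qed

lemma rcl_pred: assumes "rcl A k f" shows "rcl A k (\<lambda>xs. f xs - 1)"
proof -
  have "rec_nat 0 (\<lambda>n r. n) b = b - 1" for b :: nat by (induction b) auto
  then show ?thesis
    using rcl_primrec2[OF rcl_zero rcl_proj[of 0] rcl_zero assms] by simp
qed

lemma rcl_diff: assumes "rcl A k f" "rcl A k g" shows "rcl A k (\<lambda>xs. f xs - g xs)"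
proof -
  have "rec_nat a (\<lambda>n r. r - 1) b = a - b" for a b :: nat by (induction b) auto
  then show ?thesis
    using rcl_primrec2[OF rcl_proj[of 0] rcl_pred[OF rcl_proj[of 1]] assms] by simp
qed

lemma rcl_triangle: assumes "rcl A k f" shows "rcl A k (\<lambda>xs. triangle (f xs))"
proof -
  have "rec_nat 0 (\<lambda>n r. r + Suc n) b = triangle b" for b :: nat by (induction b) auto
  then show ?thesis
    using rcl_primrec2[OF rcl_zero rcl_add[OF rcl_proj[of 1] rcl_Suc[OF rcl_proj[of 0]]]
      rcl_zero assms] by simp
qed

lemma rcl_least:
  assumes P: "rcl A (Suc k) (\<lambda>xs. of_bool (\<not> P (hd xs) (tl xs)))" and ex: "\<And>xs. \<exists>i. P i xs"
  shows "rcl A k (\<lambda>xs. LEAST i. P i xs)"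
proof -
  obtain p where p: "\<And>i xs. length xs = k \<Longrightarrow> eval A p (i # xs) (of_bool (\<not> P i xs))"
    using P unfolding rcl_def by (metis length_Cons list.sel(1,3))
  have "eval A (Mu p) xs (LEAST i. P i xs)" if "length xs = k" for xs
  proof (rule eval.Mu)
    have "P (LEAST i. P i xs) xs" using LeastI_ex[OF ex] .
    then show "eval A p ((LEAST i. P i xs) # xs) 0"
      using p[OF that, of "LEAST i. P i xs"] by simp
    show "\<forall>z<LEAST i. P i xs. \<exists>v>0. eval A p (z # xs) v"
      using p[OF that] not_less_Least by (metis of_bool_eq(2) zero_less_one)
  qed
  then show ?thesis unfolding rcl_def by blast
qed

section \<open>Inverting the Cantor pairing function\<close>

lemma prod_encode_triangle: "prod_encode (m, n) = triangle (m + n) + m"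
  by (simp add: prod_encode_def)

lemma triangle_mono: "m \<le> n \<Longrightarrow> triangle m \<le> triangle n"
  by (induction n rule: nat_induct) (auto simp: le_Suc_eq)

text \<open>The pairing lists pairs diagonal by diagonal, and \<open>triangle k\<close> is the first
  code on the diagonal with sum \<open>k\<close>. So a search finds the diagonal of
  \<open>z\<close>, and both components follow by subtraction.\<close>

lemma triangle_root: "(LEAST k. z < triangle (Suc k)) = pfst z + psnd z"
proof (rule Least_equality)
  have z: "z = triangle (pfst z + psnd z) + pfst z"
    by (metis pair_pfst_psnd prod_encode_triangle)
  show "z < triangle (Suc (pfst z + psnd z))"
    by (subst z) simp
  show "pfst z + psnd z \<le> k" if "z < triangle (Suc k)" for k
  proof (rule ccontr)
    assume "\<not> pfst z + psnd z \<le> k"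
    then have "triangle (Suc k) \<le> triangle (pfst z + psnd z)" by (intro triangle_mono) simp
    with that z show False by linarith
  qed
qed

lemma rcl_root: assumes "rcl A k f" shows "rcl A k (\<lambda>xs. pfst (f xs) + psnd (f xs))"
proof -
  have neg: "of_bool (\<not> P) = (1::nat) - of_bool P" for P by simp
  have b: "of_bool (z < t) = (1::nat) - (Suc z - t)" for z t :: nat by auto
  have 1: "rcl A 2 (\<lambda>xs. 1 - (1 - (Suc (xs ! 1) - triangle (Suc (xs ! 0)))))"
    unfolding One_nat_def
    by (intro rcl_diff rcl_Suc rcl_zero rcl_triangle rcl_proj) auto
  have "rcl A 1 (\<lambda>xs. LEAST k. xs ! 0 < triangle (Suc k))"
  proof (rule rcl_least)
    have "eval A p xs (of_bool (\<not> tl xs ! 0 < triangle (Suc (hd xs))))"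
      if "eval A p xs (1 - (1 - (Suc (xs ! 1) - triangle (Suc (xs ! 0)))))" "length xs = Suc 1" for p xs
      using that by (cases xs; cases "tl xs") (auto simp: neg b)
    then show "rcl A (Suc 1) (\<lambda>xs. of_bool (\<not> tl xs ! 0 < triangle (Suc (hd xs))))"
      using 1 unfolding rcl_def by (metis Suc_1)
    show "\<exists>i. xs ! 0 < triangle (Suc i)" for xs :: "nat list"
      by (rule exI[of _ "xs ! 0"]) simp
  qed
  from rcl_comp1[OF this assms] show ?thesis by (simp only: nth_Cons_0 triangle_root)
qed

lemma rcl_pfst: assumes "rcl A k f" shows "rcl A k (\<lambda>xs. pfst (f xs))"
proof -
  have "pfst z = z - triangle (pfst z + psnd z)" for z
    by (metis add_diff_cancel_left' pair_pfst_psnd prod_encode_triangle)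
  then show ?thesis
    using rcl_diff[OF assms rcl_triangle[OF rcl_root[OF assms]]] by simp
qed

lemma rcl_psnd: assumes "rcl A k f" shows "rcl A k (\<lambda>xs. psnd (f xs))"
  using rcl_diff[OF rcl_root[OF assms] rcl_pfst[OF assms]] by simp

lemma rcl_pair: assumes "rcl A k f" "rcl A k g" shows "rcl A k (\<lambda>xs. pair (f xs) (g xs))"
  unfolding prod_encode_triangle by (intro rcl_add rcl_triangle assms)

lemma recursive_in_iff_rcl: "recursive_in A F \<longleftrightarrow> rcl A 1 (\<lambda>xs. F (xs ! 0))"
proof -
  have "(\<forall>x. eval A p [x] (F x)) \<longleftrightarrow> (\<forall>xs. length xs = 1 \<longrightarrow> eval A p xs (F (xs ! 0)))" for p
    by (auto simp: length_Suc_conv)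
  then show ?thesis unfolding recursive_in_def rcl_def by simp
qed

text \<open>
  Below, every function is unary: several arguments are paired into one, and a rule for an operator
  that binds a variable pairs the bound variable with the ambient argument.
\<close>

named_theorems rec_intros

lemma rc_comp: "recursive_in A F \<Longrightarrow> recursive_in A f \<Longrightarrow> recursive_in A (\<lambda>x. F (f x))"
  unfolding recursive_in_iff_rcl using rcl_comp1 by fastforce

lemma rc_id [rec_intros]: "recursive_in A (\<lambda>x. x)"
  unfolding recursive_in_iff_rcl by (intro rcl_proj) simp

lemma rc_Suc [rec_intros]: "recursive_in A f \<Longrightarrow> recursive_in A (\<lambda>x. Suc (f x))"
  unfolding recursive_in_iff_rcl by (rule rcl_Suc)

lemma rc_const [rec_intros]: "recursive_in A (\<lambda>x. c)"
  unfolding recursive_in_iff_rcl by (induction c) (auto intro: rcl_zero rcl_Suc)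

lemma rc_add [rec_intros]:
  "recursive_in A f \<Longrightarrow> recursive_in A g \<Longrightarrow> recursive_in A (\<lambda>x. f x + g x)"
  unfolding recursive_in_iff_rcl by (rule rcl_add)

lemma rc_diff [rec_intros]:
  "recursive_in A f \<Longrightarrow> recursive_in A g \<Longrightarrow> recursive_in A (\<lambda>x. f x - g x)"
  unfolding recursive_in_iff_rcl by (rule rcl_diff)

lemma rc_pfst [rec_intros]: "recursive_in A f \<Longrightarrow> recursive_in A (\<lambda>x. pfst (f x))"
  unfolding recursive_in_iff_rcl by (rule rcl_pfst)

lemma rc_psnd [rec_intros]: "recursive_in A f \<Longrightarrow> recursive_in A (\<lambda>x. psnd (f x))"
  unfolding recursive_in_iff_rcl by (rule rcl_psnd)

lemma rc_pair [rec_intros]: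
  "recursive_in A f \<Longrightarrow> recursive_in A g \<Longrightarrow> recursive_in A (\<lambda>x. pair (f x) (g x))"
  unfolding recursive_in_iff_rcl by (rule rcl_pair)

lemma rc_rec_nat [rec_intros]:
  assumes a: "recursive_in A a"
    and g: "recursive_in A (\<lambda>z. g (pfst z) (pfst (psnd z)) (psnd (psnd z)))"
    and b: "recursive_in A b"
  shows "recursive_in A (\<lambda>x. rec_nat (a x) (g x) (b x))"
proof -
  have G: "rcl A 3 (\<lambda>xs. g (xs ! 2) (xs ! 0) (xs ! 1))"
    using rcl_comp1[OF g[unfolded recursive_in_iff_rcl]
      rcl_pair[OF rcl_proj[of 2] rcl_pair[OF rcl_proj[of 0] rcl_proj[of 1]]], of 3] by simp
  show ?thesis
    using rcl_primrec2[OF a[unfolded recursive_in_iff_rcl] G rcl_proj[of 0] b[unfolded recursive_in_iff_rcl]]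
    unfolding recursive_in_iff_rcl by simp
qed

abbreviation decidable :: "nat set \<Rightarrow> (nat \<Rightarrow> bool) \<Rightarrow> bool" where
  "decidable A P \<equiv> recursive_in A (\<lambda>x. of_bool (P x))"

lemma rc_not [rec_intros]: "decidable A P \<Longrightarrow> decidable A (\<lambda>x. \<not> P x)"
proof -
  assume P: "decidable A P"
  have "(\<lambda>x. of_bool (\<not> P x) :: nat) = (\<lambda>x. 1 - of_bool (P x))" by auto
  then show ?thesis by (simp only:) (intro rec_intros P)
qed

lemma rc_if [rec_intros]:
  assumes "decidable A P" "recursive_in A f" "recursive_in A g"
  shows "recursive_in A (\<lambda>x. if P x then f x else g x)"
proof -
  \<comment> \<open>A recursion of length 0 or 1 whose step ignores counter and accumulator selects
    the branch.\<close>
  have "(\<lambda>x. if P x then f x else g x) = (\<lambda>x. rec_nat (g x) (\<lambda>_ _. f x) (of_bool (P x)))" by auto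
  then show ?thesis by (simp only:) (intro rc_rec_nat rc_comp[OF assms(2)] rec_intros assms)
qed

lemma rc_conj [rec_intros]:
  assumes "decidable A P" "decidable A Q" shows "decidable A (\<lambda>x. P x \<and> Q x)"
proof -
  have "(\<lambda>x. of_bool (P x \<and> Q x) :: nat) = (\<lambda>x. if P x then of_bool (Q x) else 0)" by auto
  then show ?thesis by (simp only:) (intro rec_intros assms)
qed

lemma rc_disj [rec_intros]:
  assumes "decidable A P" "decidable A Q" shows "decidable A (\<lambda>x. P x \<or> Q x)"
proof -
  have "(\<lambda>x. of_bool (P x \<or> Q x) :: nat) = (\<lambda>x. if P x then 1 else of_bool (Q x))" by auto
  then show ?thesis by (simp only:) (intro rec_intros assms)
qed

lemma rc_imp [rec_intros]:
  assumes "decidable A P" "decidable A Q" shows "decidable A (\<lambda>x. P x \<longrightarrow> Q x)"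
proof -
  have "(\<lambda>x. of_bool (P x \<longrightarrow> Q x) :: nat) = (\<lambda>x. if P x then of_bool (Q x) else 1)" by auto
  then show ?thesis by (simp only:) (intro rec_intros assms)
qed

lemma rc_if_bool [rec_intros]:
  assumes "decidable A P" "decidable A Q" "decidable A R"
  shows "decidable A (\<lambda>x. if P x then Q x else R x)"
  unfolding if_bool_eq_conj by (intro rec_intros assms)

lemma rc_le [rec_intros]:
  assumes "recursive_in A f" "recursive_in A g" shows "decidable A (\<lambda>x. f x \<le> g x)"
proof -
  have "(\<lambda>x. of_bool (f x \<le> g x) :: nat) = (\<lambda>x. 1 - (f x - g x))" by auto
  then show ?thesis by (simp only:) (intro rec_intros assms)
qed

lemma rc_less [rec_intros]:
  assumes "recursive_in A f" "recursive_in A g" shows "decidable A (\<lambda>x. f x < g x)"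
  using rc_le[OF rc_Suc[OF assms(1)] assms(2)] by (simp add: Suc_le_eq)

lemma rc_eq [rec_intros]:
  assumes "recursive_in A f" "recursive_in A g" shows "decidable A (\<lambda>x. f x = g x)"
  unfolding order.eq_iff by (intro rec_intros assms)

lemma rc_eq_bool [rec_intros]:
  assumes "decidable A P" "decidable A Q" shows "decidable A (\<lambda>x. P x = Q x)"
  using rc_eq[OF assms] by (simp only: of_bool_eq_iff)

lemma rc_sum [rec_intros]:
  assumes "recursive_in A b" "recursive_in A (\<lambda>z. f (pfst z) (psnd z))"
  shows "recursive_in A (\<lambda>x. \<Sum>i<b x. f x i)"
proof -
  have s: "(\<Sum>i<n. h i) = rec_nat 0 (\<lambda>i r. r + h i) n" for h :: "nat \<Rightarrow> nat" and n
    by (induction n) auto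
  have "recursive_in A (\<lambda>z. f (pfst z) (pfst (psnd z)))"
    using rc_comp[OF assms(2) rc_pair[OF rc_pfst[OF rc_id] rc_pfst[OF rc_psnd[OF rc_id]]]] by simp
  then show ?thesis unfolding s by (intro rec_intros assms)
qed

lemma rc_bex [rec_intros]:
  assumes "recursive_in A b" "decidable A (\<lambda>z. P (pfst z) (psnd z))"
  shows "decidable A (\<lambda>x. \<exists>i<b x. P x i)"
proof -
  have "(\<lambda>x. of_bool (\<exists>i<b x. P x i) :: nat) = (\<lambda>x. of_bool (0 < (\<Sum>i<b x. of_bool (P x i) :: nat)))"
    by (auto simp: fun_eq_iff sum_eq_0_iff)
  then show ?thesis by (simp only:) (intro rec_intros assms)
qed

lemma rc_ball [rec_intros]:
  assumes "recursive_in A b" "decidable A (\<lambda>z. P (pfst z) (psnd z))"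
  shows "decidable A (\<lambda>x. \<forall>i<b x. P x i)"
  using rc_not[OF rc_bex[OF assms(1) rc_not[OF assms(2)]]] by simp

lemma rc_least:
  assumes P: "decidable A (\<lambda>z. P (pfst z) (psnd z))" and ex: "\<And>x. \<exists>i. P x i"
  shows "recursive_in A (\<lambda>x. LEAST i. P x i)"
proof -
  have "rcl A 2 (\<lambda>xs. of_bool (\<not> P (xs ! 1) (xs ! 0)))"
    using rcl_comp1[OF rc_not[OF P, unfolded recursive_in_iff_rcl] rcl_pair[OF rcl_proj[of 1] rcl_proj[of 0]], of 2]
    by simp
  then have "rcl A 2 (\<lambda>xs. of_bool (\<not> P (tl xs ! 0) (hd xs)))"
    by (rule rcl_cong[rotated]) (auto simp: length_Suc_conv numeral_2_eq_2)
  then have "rcl A (Suc 1) (\<lambda>xs. of_bool (\<not> P (tl xs ! 0) (hd xs)))"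
    by (simp only: Suc_1)
  then show ?thesis unfolding recursive_in_iff_rcl using ex by (rule rcl_least)
qed

lemma rc_mult [rec_intros]:
  assumes "recursive_in A f" "recursive_in A g" shows "recursive_in A (\<lambda>x. f x * g x)"
proof -
  have "(\<lambda>x. f x * g x) = (\<lambda>x. rec_nat 0 (\<lambda>i r. r + f x) (g x))"
  proof
    fix x
    have "f x * n = rec_nat 0 (\<lambda>i r. r + f x) n" for n by (induction n) auto
    then show "f x * g x = rec_nat 0 (\<lambda>i r. r + f x) (g x)" .
  qed
  then show ?thesis by (simp only:) (intro rec_intros rc_comp[OF assms(1)] assms)
qed

lemma rc_power [rec_intros]:
  assumes "recursive_in A f" "recursive_in A g" shows "recursive_in A (\<lambda>x. f x ^ g x)"
proof -
  have "b ^ n = rec_nat 1 (\<lambda>i r. r * b) n" for b n :: nat by (induction n) auto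
  then show ?thesis by (simp only:) (intro rec_intros rc_comp[OF assms(1)] assms)
qed

lemma rc_div [rec_intros]:
  assumes "recursive_in A f" "recursive_in A g" shows "recursive_in A (\<lambda>x. f x div g x)"
proof -
  \<comment> \<open>The disjunct \<open>y = 0\<close> keeps the search total, and the search then
    returns 0, the value of division by zero.\<close>
  have "x div y = (LEAST k. y = 0 \<or> x < Suc k * y)" for x y :: nat
  proof (cases "y = 0")
    case False
    then have "(y = 0 \<or> x < Suc k * y) \<longleftrightarrow> x div y \<le> k" for k
      using div_less_iff_less_mult[of y x "Suc k"] False by (metis gr0I less_Suc_eq_le)
    then have "(LEAST k. y = 0 \<or> x < Suc k * y) = (LEAST k. x div y \<le> k)" by presburger
    also have "\<dots> = x div y" by (intro Least_equality) auto
    finally show ?thesis ..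
  qed (simp add: Least_equality)
  moreover have "\<exists>k. y = 0 \<or> x < Suc k * y" for x y :: nat
    by (rule exI[of _ x]) (cases y; auto)
  ultimately show ?thesis
    by (simp only:) (intro rc_least rec_intros rc_comp[OF assms(1)] rc_comp[OF assms(2)])
qed

lemma rc_mod [rec_intros]:
  assumes "recursive_in A f" "recursive_in A g" shows "recursive_in A (\<lambda>x. f x mod g x)"
  unfolding minus_mult_div_eq_mod[symmetric] by (intro rec_intros assms)

lemma rc_funpow [rec_intros]:
  assumes "recursive_in A f" "recursive_in A g" "recursive_in A h"
  shows "recursive_in A (\<lambda>x. (f ^^ g x) (h x))"
proof -
  have "(f ^^ n) y = rec_nat y (\<lambda>_ r. f r) n" for n y by (induction n) auto
  then show ?thesis by (simp only:) (intro rec_intros rc_comp[OF assms(1)] assms)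
qed

lemma rc_set_decode [rec_intros]:
  assumes "recursive_in A f" "recursive_in A g"
  shows "decidable A (\<lambda>x. f x \<in> set_decode (g x))"
  unfolding set_decode_def mem_Collect_eq odd_iff_mod_2_eq_one by (intro rec_intros assms)

lemma set_encode_Collect: "set_encode {i. i < n \<and> P i} = (\<Sum>i<n. of_bool (P i) * 2 ^ i)"
proof -
  have "set_encode {i. i < n \<and> P i} = (\<Sum>i | i < n \<and> P i. 2 ^ i)" by (simp add: set_encode_def)
  also have "\<dots> = (\<Sum>i<n. of_bool (P i) * 2 ^ i)"
    by (rule sum.mono_neutral_cong_left) auto
  finally show ?thesis .
qed

lemma rc_set_encode [rec_intros]:
  assumes "recursive_in A b" "decidable A (\<lambda>z. P (pfst z) (psnd z))"
  shows "recursive_in A (\<lambda>x. set_encode {i. i < b x \<and> P x i})"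
  unfolding set_encode_Collect by (intro rec_intros assms)

lemma recursive_in_oracle: "decidable A (\<lambda>x. x \<in> A)"
  using turing_le_refl unfolding turing_le_def .

section \<open>Simulation of oracle programs\<close>

text \<open>Since 0 codes the empty list and \<open>psnd (0 - 1) = 0\<close>, dropping past the end
  stays at 0. Whether \<open>ldrop i z\<close> is 0 thus tells whether the list has a position
  \<open>i\<close>.\<close>

definition ldrop :: "nat \<Rightarrow> nat \<Rightarrow> nat" where
  "ldrop i z = ((\<lambda>r. psnd (r - 1)) ^^ i) z"

definition lnth :: "nat \<Rightarrow> nat \<Rightarrow> nat" where
  "lnth z i = pfst (ldrop i z - 1)"

lemma psnd_0 [simp]: "psnd 0 = 0"
  by (metis le_prod_encode_2 le_zero_eq pair_pfst_psnd)

lemma pfst_le: "pfst z \<le> z" and psnd_le: "psnd z \<le> z"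
  by (metis le_prod_encode_1 pair_pfst_psnd, metis le_prod_encode_2 pair_pfst_psnd)

lemma ldrop_list_encode: "ldrop i (list_encode xs) = list_encode (drop i xs)"
proof (induction i arbitrary: xs)
  case (Suc i)
  have "ldrop (Suc i) z = ldrop i (psnd (z - 1))" for z
    unfolding ldrop_def funpow_Suc_right by simp
  then show ?case by (cases xs) (use Suc[of "[]"] Suc in auto)
qed (simp add: ldrop_def)

lemma ldrop_eq_0_iff: "ldrop i (list_encode xs) = 0 \<longleftrightarrow> length xs \<le> i"
proof -
  have "list_encode ys = 0 \<longleftrightarrow> ys = []" for ys by (cases ys) auto
  then show ?thesis by (simp add: ldrop_list_encode)
qed

lemma lnth_list_encode: "i < length xs \<Longrightarrow> lnth (list_encode xs) i = xs ! i"
  by (simp add: lnth_def ldrop_list_encode Cons_nth_drop_Suc[symmetric])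

lemma list_encode_elem_less: "x \<in> set xs \<Longrightarrow> x < list_encode xs"
  by (induction xs) (auto simp: less_Suc_eq_le intro: le_trans[OF less_imp_le le_prod_encode_2] le_prod_encode_1)

lemma length_le_list_encode: "length xs \<le> list_encode xs"
  by (induction xs) (auto intro: le_trans[OF _ le_prod_encode_2])

lemma list_decode_elem_less: "x \<in> set (list_decode z) \<Longrightarrow> x < z"
  using list_encode_elem_less[of x "list_decode z"] by simp

lemma list_decode_elem_psnd: "x \<in> set (list_decode (psnd z)) \<Longrightarrow> x < z"
  using list_decode_elem_less[of x "psnd z"] psnd_le[of z] by simp

text \<open>For the termination of \<open>dec\<close>: \<open>e div 7\<close> is below
  \<open>e\<close> unless \<open>e = 0\<close>, where the residue is 0 and no recursive call is
  made.\<close>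

lemma less_of_le_div7: "k \<le> e div 7 \<Longrightarrow> e mod 7 \<noteq> 0 \<Longrightarrow> k < (e::nat)"
proof -
  assume "k \<le> e div 7" "e mod 7 \<noteq> 0"
  moreover from this have "0 < e" by (cases e) auto
  then have "e div 7 < e" by simp
  ultimately show "k < e" by simp
qed

text \<open>The residue is the constructor and the quotient holds the arguments, so every number
  names a program and every tree number names an opponent.\<close>

function dec :: "nat \<Rightarrow> oprog" where
  "dec e = (let k = e div 7 in
     if e mod 7 = 0 then Zero else if e mod 7 = 1 then Succ else if e mod 7 = 2 then Proj k
     else if e mod 7 = 3 then Oracle
     else if e mod 7 = 4 then Comp (dec (pfst k)) (map dec (list_decode (psnd k)))
     else if e mod 7 = 5 then PrimRec (dec (pfst k)) (dec (psnd k))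
     else Mu (dec k))"
  by auto
termination
  by (relation "Wellfounded.measure id")
    (auto intro: less_of_le_div7 pfst_le psnd_le less_imp_le[OF list_decode_elem_psnd])

declare dec.simps [simp del]

lemma dec_code: "r < 7 \<Longrightarrow> dec (7 * k + r) =
    (if r = 0 then Zero else if r = 1 then Succ else if r = 2 then Proj k
     else if r = 3 then Oracle
     else if r = 4 then Comp (dec (pfst k)) (map dec (list_decode (psnd k)))
     else if r = 5 then PrimRec (dec (pfst k)) (dec (psnd k))
     else Mu (dec k))"
  by (subst dec.simps) (simp add: Let_def)

lemma dec_surj: "\<exists>e. dec e = p"
proof (induction p)
  case Zero
  show ?case using dec_code[of 0 0] by (intro exI[of _ 0]) simp
next
  case Succ
  show ?case using dec_code[of 1 0] by (intro exI[of _ 1]) simp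
next
  case (Proj k)
  show ?case using dec_code[of 2 k] by (intro exI[of _ "7 * k + 2"]) simp
next
  case Oracle
  show ?case using dec_code[of 3 0] by (intro exI[of _ 3]) simp
next
  case (Comp f gs)
  then obtain e c where e: "dec e = f" and c: "\<And>g. g \<in> set gs \<Longrightarrow> dec (c g) = g" by metis
  have "map dec (map c gs) = gs" by (simp add: c map_idI)
  then show ?case
    using dec_code[of 4 "pair e (list_encode (map c gs))"] e
    by (intro exI[of _ "7 * pair e (list_encode (map c gs)) + 4"]) (simp del: map_map)
next
  case (PrimRec f g)
  then obtain e1 e2 where "dec e1 = f" "dec e2 = g" by auto
  then show ?case
    using dec_code[of 5 "pair e1 e2"] by (intro exI[of _ "7 * pair e1 e2 + 5"]) simp
next
  case (Mu f)
  then obtain e where "dec e = f" by auto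
  then show ?case using dec_code[of 6 e] by (intro exI[of _ "7 * e + 6"]) simp
qed

abbreviation fact_code :: "nat \<Rightarrow> nat \<Rightarrow> nat \<Rightarrow> nat" where
  "fact_code e xs y \<equiv> pair e (pair xs y)"

text \<open>
  One derivation step from the set coded by \<open>E\<close>. The oracle is only known below \<open>b\<close>,
  where it is given by the binary digits of \<open>u\<close>; all quantifiers are bounded by \<open>s\<close>.
\<close>

definition comp_step :: "nat \<Rightarrow> nat \<Rightarrow> nat \<Rightarrow> nat \<Rightarrow> nat \<Rightarrow> bool" where
  "comp_step s E k xs y \<longleftrightarrow> (\<exists>ys<s. (\<forall>i<s. (ldrop i ys = 0) = (ldrop i (psnd k) = 0) \<and>
      (ldrop i ys \<noteq> 0 \<longrightarrow> fact_code (lnth (psnd k) i) xs (lnth ys i) \<in> set_decode E)) \<and>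
      fact_code (pfst k) ys y \<in> set_decode E)"

definition rec_step :: "nat \<Rightarrow> nat \<Rightarrow> nat \<Rightarrow> nat \<Rightarrow> nat \<Rightarrow> nat \<Rightarrow> bool" where
  "rec_step s E e k xs y \<longleftrightarrow> xs \<noteq> 0 \<and>
     (if pfst (xs - 1) = 0 then fact_code (pfst k) (psnd (xs - 1)) y \<in> set_decode E
      else \<exists>r<s. fact_code e (Suc (pair (pfst (xs - 1) - 1) (psnd (xs - 1)))) r \<in> set_decode E \<and>
        fact_code (psnd k) (Suc (pair (pfst (xs - 1) - 1) (Suc (pair r (psnd (xs - 1)))))) y
          \<in> set_decode E)"

definition mu_step :: "nat \<Rightarrow> nat \<Rightarrow> nat \<Rightarrow> nat \<Rightarrow> nat \<Rightarrow> bool" where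
  "mu_step s E k xs y \<longleftrightarrow> fact_code k (Suc (pair y xs)) 0 \<in> set_decode E \<and>
     (\<forall>z<y. \<exists>v<s. 0 < v \<and> fact_code k (Suc (pair z xs)) v \<in> set_decode E)"

definition step :: "nat \<Rightarrow> nat \<Rightarrow> nat \<Rightarrow> nat \<Rightarrow> nat \<Rightarrow> nat \<Rightarrow> nat \<Rightarrow> bool" where
  "step b u s E e xs y \<longleftrightarrow> (let k = e div 7; x = pfst (xs - 1) in
     (e mod 7 = 0 \<and> y = 0) \<or>
     (e mod 7 = 1 \<and> xs \<noteq> 0 \<and> psnd (xs - 1) = 0 \<and> y = Suc x) \<or>
     (e mod 7 = 2 \<and> ldrop k xs \<noteq> 0 \<and> y = lnth xs k) \<or>
     (e mod 7 = 3 \<and> xs \<noteq> 0 \<and> psnd (xs - 1) = 0 \<and> x < b \<and> y = of_bool (x \<in> set_decode u)) \<or>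
     (e mod 7 = 4 \<and> comp_step s E k xs y) \<or>
     (e mod 7 = 5 \<and> rec_step s E e k xs y) \<or>
     (e mod 7 = 6 \<and> mu_step s E k xs y))"

text \<open>Derivable facts are tabulated bottom-up in one number. This turns the partial relation
  \<open>eval\<close> into a total recursive function of the stage: divergence is absence from all
  tables.\<close>

definition sim :: "nat \<Rightarrow> nat \<Rightarrow> nat \<Rightarrow> nat" where
  "sim b u s = rec_nat 0 (\<lambda>s E. set_encode {f. f < s \<and> step b u s E (pfst f) (pfst (psnd f)) (psnd (psnd f))}) s"

lemma sim_0: "set_decode (sim b u 0) = {}"
  by (simp add: sim_def)

lemma sim_Suc: "f \<in> set_decode (sim b u (Suc s)) \<longleftrightarrow>
    f < s \<and> step b u s (sim b u s) (pfst f) (pfst (psnd f)) (psnd (psnd f))"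
  by (simp add: sim_def set_encode_inverse)

text \<open>The rules use \<open>E\<close> positively and bound their witnesses by \<open>s\<close>,
  so they only become weaker. The exception is the length comparison in \<open>comp_step\<close>, a
  universal quantifier bounded by \<open>s\<close>.\<close>

lemma step_mono:
  assumes "step b u s E e xs y" "s \<le> s'" "b \<le> b'" "set_decode E \<subseteq> set_decode E'"
    "\<And>i. i < b \<Longrightarrow> i \<in> set_decode u \<longleftrightarrow> i \<in> set_decode u'" "fact_code e xs y < s"
  shows "step b' u' s' E' e xs y"
proof -
  note ss = order.strict_trans2[OF _ assms(2)]
  note bb = order.strict_trans2[OF _ assms(3)]
  have k: "psnd (e div 7) < s"
    using assms(6) psnd_le[of "e div 7"] le_prod_encode_1[of e "pair xs y"]
      div_le_dividend[of e 7] by linarith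
  have c: "comp_step s' E' (e div 7) xs y" if C: "comp_step s E (e div 7) xs y"
  proof -
    obtain ys where ys: "ys < s" "fact_code (pfst (e div 7)) ys y \<in> set_decode E"
      "\<And>i. i < s \<Longrightarrow> (ldrop i ys = 0) = (ldrop i (psnd (e div 7)) = 0)"
      "\<And>i. i < s \<Longrightarrow> ldrop i ys \<noteq> 0 \<Longrightarrow>
         fact_code (lnth (psnd (e div 7)) i) xs (lnth ys i) \<in> set_decode E"
      using C unfolding comp_step_def by blast
    \<comment> \<open>A list is no longer than its code, and both codes are below \<open>s\<close>;
      positions from \<open>s\<close> on lie past both ends, so a larger stage compares nothing
      new.\<close>
    have big: "ldrop i z = 0" if "z < s" "\<not> i < s" for i z
      using that ldrop_eq_0_iff[of i "list_decode z"] length_le_list_encode[of "list_decode z"]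
      by simp
    show ?thesis unfolding comp_step_def
    proof (intro exI[of _ ys] conjI allI impI)
      show "(ldrop i ys = 0) = (ldrop i (psnd (e div 7)) = 0)" for i
        using ys(3)[of i] big[of ys i] big[of "psnd (e div 7)" i] ys(1) k by blast
      show "fact_code (lnth (psnd (e div 7)) i) xs (lnth ys i) \<in> set_decode E'"
        if "ldrop i ys \<noteq> 0" for i
      proof -
        have "i < s" by (rule ccontr) (use that big[OF ys(1)] in simp)
        then show ?thesis using subsetD[OF assms(4) ys(4)[OF _ that]] by simp
      qed
    qed (use ys ss assms(4) in auto)
  qed
  have r: "rec_step s' E' e (e div 7) xs y" if "rec_step s E e (e div 7) xs y"
    using that assms(4) unfolding rec_step_def by (auto split: if_splits intro: ss)
  have m: "mu_step s' E' (e div 7) xs y" if "mu_step s E (e div 7) xs y"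
    using that assms(4) unfolding mu_step_def by (meson ss subsetD)
  show ?thesis
    using assms(1) unfolding step_def Let_def
    by (elim disjE conjE) (simp_all add: c r m bb assms(5))
qed

lemma sim_mono:
  assumes "s \<le> s'" "b \<le> b'" "\<And>i. i < b \<Longrightarrow> i \<in> set_decode u \<longleftrightarrow> i \<in> set_decode u'"
  shows "set_decode (sim b u s) \<subseteq> set_decode (sim b' u' s')"
  using assms(1)
proof (induction s arbitrary: s')
  case 0
  show ?case by (simp add: sim_0)
next
  case (Suc s)
  then obtain s1 where s': "s' = Suc s1" "s \<le> s1" by (cases s') auto
  show ?case
  proof
    fix f assume "f \<in> set_decode (sim b u (Suc s))"
    then have f: "f < s" "step b u s (sim b u s) (pfst f) (pfst (psnd f)) (psnd (psnd f))"
      by (auto simp: sim_Suc)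
    have "step b' u' s1 (sim b' u' s1) (pfst f) (pfst (psnd f)) (psnd (psnd f))"
      by (rule step_mono[OF f(2) s'(2) assms(2) Suc.IH[OF s'(2)] assms(3)]) (use f in auto)
    then show "f \<in> set_decode (sim b' u' s')" using f(1) s' by (simp add: sim_Suc)
  qed
qed

lemma step_sound:
  assumes E: "\<And>e xs y. fact_code e xs y \<in> set_decode E \<Longrightarrow> eval A (dec e) (list_decode xs) y"
    and fact: "step b u s E e xs y" "fact_code e xs y < s"
    and A: "\<And>i. i < b \<Longrightarrow> i \<in> A \<longleftrightarrow> i \<in> set_decode u"
  shows "eval A (dec e) (list_decode xs) y"
proof -
  define k where "k = e div 7"
  note d = dec.simps[of e, unfolded Let_def, folded k_def]
  have es: "e < s" and xss: "xs < s"
    using fact(2) le_prod_encode_1[of e "pair xs y"] le_prod_encode_2[of "pair xs y" e]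
      le_prod_encode_1[of xs y] by linarith+
  have xs: "list_decode xs = pfst (xs - 1) # list_decode (psnd (xs - 1))" if "xs \<noteq> 0"
    using that by (cases xs) (auto simp: pfst_def psnd_def split: prod.split)
  have nil: "list_decode 0 = []" by simp
  consider "e mod 7 = 0" "y = 0"
    | "e mod 7 = 1" "xs \<noteq> 0" "psnd (xs - 1) = 0" "y = Suc (pfst (xs - 1))"
    | "e mod 7 = 2" "ldrop k xs \<noteq> 0" "y = lnth xs k"
    | "e mod 7 = 3" "xs \<noteq> 0" "psnd (xs - 1) = 0" "pfst (xs - 1) < b"
        "y = of_bool (pfst (xs - 1) \<in> set_decode u)"
    | "e mod 7 = 4" "comp_step s E k xs y"
    | "e mod 7 = 5" "rec_step s E e k xs y"
    | "e mod 7 = 6" "mu_step s E k xs y"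
    using fact(1) unfolding step_def Let_def k_def by (elim disjE conjE) iprover+
  then show ?thesis
  proof cases
    case 1
    then show ?thesis unfolding d by (simp add: eval.Zero)
  next
    case 2
    then show ?thesis unfolding d xs[OF 2(2)] by (simp add: eval.Succ nil)
  next
    case 3
    have "k < length (list_decode xs)" using 3 ldrop_eq_0_iff[of k "list_decode xs"] by simp
    moreover have "y = list_decode xs ! k"
      using 3 calculation lnth_list_encode[of k "list_decode xs"] by simp
    ultimately show ?thesis unfolding d using 3 by (simp add: eval.Proj)
  next
    case 4
    have "y = of_bool (pfst (xs - 1) \<in> A)" using 4 A by simp
    then show ?thesis unfolding d xs[OF 4(2)] using 4 by (simp only:) (simp add: eval.Oracle)
  next
    case 5
    obtain ys where ys: "ys < s" "fact_code (pfst k) ys y \<in> set_decode E"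
      "\<And>i. i < s \<Longrightarrow> (ldrop i ys = 0) = (ldrop i (psnd k) = 0)"
      "\<And>i. i < s \<Longrightarrow> ldrop i ys \<noteq> 0 \<Longrightarrow>
         fact_code (lnth (psnd k) i) xs (lnth ys i) \<in> set_decode E"
      using 5(2) unfolding comp_step_def by blast
    define gs where "gs = list_decode (psnd k)"
    define zs where "zs = list_decode ys"
    have codes: "psnd k = list_encode gs" "ys = list_encode zs" by (simp_all add: gs_def zs_def)
    have "psnd k < s" using es psnd_le[of k] div_le_dividend[of e 7] unfolding k_def by linarith
    then have len: "length gs < s" "length zs < s"
      using length_le_list_encode[of gs] length_le_list_encode[of zs] ys(1) codes by linarith+
    have iff: "length zs \<le> i \<longleftrightarrow> length gs \<le> i" if "i < s" for i
      using ys(3)[OF that] unfolding codes ldrop_eq_0_iff .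
    have leq: "length zs = length gs"
      using iff[OF len(1)] iff[OF len(2)] by simp
    have "eval A (dec (gs ! i)) (list_decode xs) (zs ! i)" if "i < length gs" for i
    proof -
      have "fact_code (lnth (psnd k) i) xs (lnth ys i) \<in> set_decode E"
        using ys(4)[of i] that len leq unfolding codes ldrop_eq_0_iff by simp
      then show ?thesis using E that leq unfolding codes by (simp add: lnth_list_encode)
    qed
    moreover have "eval A (dec (pfst k)) zs y"
      using E[OF ys(2)] by (simp add: zs_def)
    ultimately have "eval A (Comp (dec (pfst k)) (map dec gs)) (list_decode xs) y"
      using leq by (intro eval.Comp[of zs]) auto
    then show ?thesis unfolding d using 5 by (simp add: gs_def)
  next
    case 6
    then have "xs \<noteq> 0" by (simp add: rec_step_def)
    note xs = xs[OF this]
    show ?thesis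
    proof (cases "pfst (xs - 1)")
      case 0
      then have "eval A (dec (pfst k)) (list_decode (psnd (xs - 1))) y"
        using 6(2) E unfolding rec_step_def by simp
      then show ?thesis unfolding d xs 0 using 6 by (simp add: eval.PrimRec_0)
    next
      case (Suc m)
      then obtain r where r: "fact_code e (Suc (pair m (psnd (xs - 1)))) r \<in> set_decode E"
        "fact_code (psnd k) (Suc (pair m (Suc (pair r (psnd (xs - 1)))))) y \<in> set_decode E"
        using 6(2) unfolding rec_step_def by auto
      have "dec e = PrimRec (dec (pfst k)) (dec (psnd k))"
        unfolding d using 6 by (simp)
      then show ?thesis
        using E[OF r(1)] E[OF r(2)] eval.PrimRec_Suc[of A "dec (pfst k)" "dec (psnd k)" m _ r y]
        unfolding xs Suc by simp
    qed
  next
    case 7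
    have "eval A (dec k) (y # list_decode xs) 0"
      using 7(2) E[of k "Suc (pair y xs)"] unfolding mu_step_def by simp
    moreover have "\<exists>v>0. eval A (dec k) (z # list_decode xs) v" if zy: "z < y" for z
    proof -
      obtain v where "0 < v" "fact_code k (Suc (pair z xs)) v \<in> set_decode E"
        using 7(2) zy unfolding mu_step_def by metis
      then show ?thesis using E[of k "Suc (pair z xs)" v] by auto
    qed
    ultimately show ?thesis unfolding d using 7 by (simp add: eval.Mu)
  qed
qed

lemma sim_sound:
  assumes "\<And>i. i < b \<Longrightarrow> i \<in> A \<longleftrightarrow> i \<in> set_decode u"
  shows "fact_code e xs y \<in> set_decode (sim b u s) \<Longrightarrow> eval A (dec e) (list_decode xs) y"
proof (induction s arbitrary: e xs y)
  case 0
  then show ?case by (simp add: sim_0)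
next
  case (Suc s)
  then show ?case
    using step_sound[of "sim b u s" A b u s e xs y] assms by (simp add: sim_Suc)
qed

lemma sim_mono_diag:
  assumes "f \<in> set_decode (sim t (set_encode {i. i < t \<and> X i}) t)" "t \<le> t'"
  shows "f \<in> set_decode (sim t' (set_encode {i. i < t' \<and> X i}) t')"
  using subsetD[OF sim_mono assms(1)] assms(2) by (simp add: set_encode_inverse)


section \<open>Completeness of the simulation\<close>

text \<open>The known part \<open>b\<close> of the oracle is quantified apart from the stage
  \<open>t\<close>: a fact of stage \<open>Suc t\<close> looks up its premises in
  \<open>sim b u t\<close> with the same \<open>b\<close>, which exceeds \<open>t\<close>.\<close>

definition derived :: "nat set \<Rightarrow> nat \<Rightarrow> nat \<Rightarrow> bool" where
  "derived A f t \<longleftrightarrow> (\<forall>b\<ge>t. \<forall>u. (\<forall>i<b. i \<in> A \<longleftrightarrow> i \<in> set_decode u) \<longrightarrow> f \<in> set_decode (sim b u t))"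

lemma eventually_derived_step:
  assumes "\<forall>\<^sub>F t in sequentially. \<forall>b\<ge>t. \<forall>u. (\<forall>i<b. i \<in> A \<longleftrightarrow> i \<in> set_decode u) \<longrightarrow>
     step b u t (sim b u t) e xs y"
  shows "\<forall>\<^sub>F t in sequentially. derived A (fact_code e xs y) t"
proof -
  \<comment> \<open>What follows from the table of stage \<open>t\<close> and has a code below
    \<open>t\<close> enters the table of stage \<open>Suc t\<close>.\<close>
  have "\<forall>\<^sub>F t in sequentially. derived A (fact_code e xs y) (Suc t)"
    using eventually_conj[OF assms eventually_gt_at_top[of "fact_code e xs y"]]
    by (rule eventually_mono) (auto simp: derived_def sim_Suc)
  then show ?thesis by (simp only: eventually_sequentially_Suc)
qed

lemma eval_derived:
  "eval A p xs y \<Longrightarrow> dec e = p \<Longrightarrow> \<forall>\<^sub>F t in sequentially. derived A (fact_code e (list_encode xs) y) t"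
proof (induction arbitrary: e rule: eval.induct)
  case (Zero xs)
  then have "e mod 7 = 0" using dec.simps[of e] by (auto simp: Let_def split: if_splits)
  then show ?case by (intro eventually_derived_step always_eventually) (simp add: step_def)
next
  case (Succ x)
  then have "e mod 7 = 1" using dec.simps[of e] by (auto simp: Let_def split: if_splits)
  then show ?case by (intro eventually_derived_step always_eventually) (simp add: step_def)
next
  case (Proj i xs)
  then have "e mod 7 = 2" "e div 7 = i" using dec.simps[of e] by (auto simp: Let_def split: if_splits)
  then show ?case using Proj(1)
    by (intro eventually_derived_step always_eventually)
      (auto simp add: step_def ldrop_eq_0_iff lnth_list_encode)
next
  case (Oracle x)
  then have "e mod 7 = 3" using dec.simps[of e] by (auto simp: Let_def split: if_splits)
  then show ?case
    using eventually_gt_at_top[of x]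
    by (intro eventually_derived_step, elim eventually_mono) (auto simp: step_def)
next
  case (Comp ys gs xs f z)
  define k where "k = e div 7"
  define cs where "cs = list_decode (psnd k)"
  have e: "e mod 7 = 4" "dec (pfst k) = f" "map dec cs = gs"
    using Comp.prems dec.simps[of e] by (auto simp: Let_def k_def cs_def split: if_splits)
  have k: "psnd k = list_encode cs" by (simp add: cs_def)
  have "\<forall>\<^sub>F t in sequentially. derived A (fact_code (cs ! i) (list_encode xs) (ys ! i)) t"
    if "i < length gs" for i
    using Comp.IH(1) that e(3) by auto
  then have "\<forall>\<^sub>F t in sequentially. \<forall>i\<in>{..<length gs}.
      derived A (fact_code (cs ! i) (list_encode xs) (ys ! i)) t"
    by (intro eventually_ball_finite) auto
  moreover have "\<forall>\<^sub>F t in sequentially. derived A (fact_code (pfst k) (list_encode ys) z) t"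
    using Comp.IH(2) e(2) by blast
  ultimately have "\<forall>\<^sub>F t in sequentially. list_encode ys < t \<and>
      derived A (fact_code (pfst k) (list_encode ys) z) t \<and>
      (\<forall>i<length gs. derived A (fact_code (cs ! i) (list_encode xs) (ys ! i)) t)"
    using eventually_gt_at_top[of "list_encode ys"] by eventually_elim auto
  then show ?case
  proof (intro eventually_derived_step, elim eventually_mono, intro allI impI)
    fix t b u
    assume t: "list_encode ys < t \<and> derived A (fact_code (pfst k) (list_encode ys) z) t \<and>
        (\<forall>i<length gs. derived A (fact_code (cs ! i) (list_encode xs) (ys ! i)) t)"
      and b: "t \<le> b" "\<forall>i<b. (i \<in> A) = (i \<in> set_decode u)"
    have len: "length ys = length cs" "length gs = length cs" using Comp.hyps e(3) by auto
    have "comp_step t (sim b u t) k (list_encode xs) z"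
      unfolding comp_step_def
    proof (intro exI[of _ "list_encode ys"] conjI allI impI)
      fix i
      show "(ldrop i (list_encode ys) = 0) = (ldrop i (psnd k) = 0)"
        unfolding k ldrop_eq_0_iff len ..
      assume "ldrop i (list_encode ys) \<noteq> 0"
      then have "i < length cs" by (simp add: ldrop_eq_0_iff len)
      then show "fact_code (lnth (psnd k) i) (list_encode xs) (lnth (list_encode ys) i)
          \<in> set_decode (sim b u t)"
        using t b unfolding k by (simp add: lnth_list_encode len derived_def)
    qed (use t b in \<open>simp_all add: derived_def\<close>)
    then show "step b u t (sim b u t) e (list_encode xs) z"
      using e(1) by (simp add: step_def k_def)
  qed
next
  case (PrimRec_0 f xs y g)
  have e: "e mod 7 = 5" "dec (pfst (e div 7)) = f"
    using PrimRec_0.prems dec.simps[of e] by (auto simp: Let_def split: if_splits)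
  show ?case
    using PrimRec_0.IH[OF e(2)]
    by (intro eventually_derived_step, elim eventually_mono)
      (simp add: step_def e rec_step_def derived_def)
next
  case (PrimRec_Suc f g n xs r y)
  have e: "e mod 7 = 5" "dec (psnd (e div 7)) = g"
    using PrimRec_Suc.prems dec.simps[of e] by (auto simp: Let_def split: if_splits)
  show ?case
    using PrimRec_Suc.IH(1)[OF PrimRec_Suc.prems] PrimRec_Suc.IH(2)[OF e(2)]
      eventually_gt_at_top[of r]
    by (intro eventually_derived_step, eventually_elim)
      (auto simp add: step_def e rec_step_def derived_def)
next
  case (Mu f y xs)
  define k where "k = e div 7"
  have e: "e mod 7 = 6" "dec k = f"
    using Mu.prems dec.simps[of e] mod_less_divisor[of 7 e]
    by (auto simp: Let_def k_def split: if_splits)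
  obtain v where v: "\<And>z. z < y \<Longrightarrow> 0 < v z" and
    ev: "\<And>z. z < y \<Longrightarrow>
      \<forall>\<^sub>F t in sequentially. derived A (fact_code k (list_encode (z # xs)) (v z)) t"
    using Mu.IH(2) e(2) by metis
  have "\<forall>\<^sub>F t in sequentially. \<forall>z\<in>{..<y}.
      v z < t \<and> derived A (fact_code k (list_encode (z # xs)) (v z)) t"
    by (intro eventually_ball_finite ballI eventually_conj ev eventually_gt_at_top) auto
  then show ?case
    using Mu.IH(1)[OF e(2)]
  proof (intro eventually_derived_step, eventually_elim, intro allI impI)
    fix t b u
    assume *: "\<forall>z\<in>{..<y}. v z < t \<and> derived A (fact_code k (list_encode (z # xs)) (v z)) t"
      "derived A (fact_code k (list_encode (y # xs)) 0) t"
      and b: "t \<le> b" "\<forall>i<b. (i \<in> A) = (i \<in> set_decode u)"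
    have "mu_step t (sim b u t) k (list_encode xs) y"
      unfolding mu_step_def
    proof (intro conjI allI impI)
      show "\<exists>w<t. 0 < w \<and> fact_code k (Suc (pair z (list_encode xs))) w \<in> set_decode (sim b u t)"
        if "z < y" for z
        using that * b v by (intro exI[of _ "v z"]) (auto simp: derived_def)
    qed (use * b in \<open>simp add: derived_def\<close>)
    then show "step b u t (sim b u t) e (list_encode xs) y"
      using e by (simp add: step_def k_def)
  qed
qed

definition oracle_code :: "(nat \<Rightarrow> bool) \<Rightarrow> nat \<Rightarrow> nat" where
  "oracle_code X t = set_encode {i. i < t \<and> X i}"

definition computes :: "nat \<Rightarrow> nat \<Rightarrow> nat \<Rightarrow> nat \<Rightarrow> nat \<Rightarrow> bool" where
  "computes t u e x y \<longleftrightarrow> fact_code e (Suc (pair x 0)) y \<in> set_decode (sim t u t)"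

lemma set_decode_oracle_code [simp]: "set_decode (oracle_code X t) = {i. i < t \<and> X i}"
  by (simp add: oracle_code_def set_encode_inverse)

text \<open>The use principle: a halting computation consults a finite part of the oracle, which a
  late enough stage covers; conversely the tables contain only true facts.\<close>

lemma eval_iff_computes:
  "eval {i. X i} (dec e) [x] y \<longleftrightarrow> (\<exists>t. computes t (oracle_code X t) e x y)"
proof
  assume "eval {i. X i} (dec e) [x] y"
  from eventually_happens'[OF _ eval_derived[OF this refl]]
  obtain t where "derived {i. X i} (fact_code e (list_encode [x]) y) t" by auto
  then have "computes t (oracle_code X t) e x y" by (simp add: derived_def computes_def)
  then show "\<exists>t. computes t (oracle_code X t) e x y" ..
next
  assume "\<exists>t. computes t (oracle_code X t) e x y"
  then obtain t where "computes t (oracle_code X t) e x y" ..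
  then show "eval {i. X i} (dec e) [x] y"
    using sim_sound[of t "{i. X i}" "oracle_code X t" e "Suc (pair x 0)" y t]
    by (simp add: computes_def)
qed

lemma computes_mono:
  assumes "computes t (oracle_code X t) e x y" "t \<le> t'"
  shows "computes t' (oracle_code X t') e x y"
  using sim_mono_diag assms unfolding computes_def oracle_code_def by blast

lemma rc_sim [rec_intros]:
  assumes "recursive_in A f" "recursive_in A g" "recursive_in A h"
  shows "recursive_in A (\<lambda>x. sim (f x) (g x) (h x))"
  unfolding sim_def step_def comp_step_def rec_step_def mu_step_def ldrop_def lnth_def Let_def
  by (intro rec_intros rc_comp[OF assms(1)] rc_comp[OF assms(2)] assms)

lemma rc_computes [rec_intros]:
  assumes "recursive_in A f" "recursive_in A g" "recursive_in A h" "recursive_in A k" "recursive_in A l"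
  shows "decidable A (\<lambda>x. computes (f x) (g x) (h x) (k x) (l x))"
  unfolding computes_def by (intro rec_intros assms)

section \<open>Fair coin tossing\<close>

interpretation fair_coin: product_prob_space "\<lambda>_::nat. measure_pmf (bernoulli_pmf (1/2))" UNIV
  by standard

interpretation coin: prob_space fair_coin_measure
  unfolding fair_coin_measure_def by (rule fair_coin.prob_space_axioms)

lemma space_fair_coin [simp]: "space fair_coin_measure = UNIV"
  by (simp add: fair_coin_measure_def space_PiM PiE_UNIV_domain)

lemma oracle_code_less: "oracle_code X t < 2 ^ t"
proof -
  have "oracle_code X t \<le> (\<Sum>i<t. 2 ^ i)"
    unfolding oracle_code_def set_encode_def by (rule sum_mono2) auto
  also have "\<dots> < 2 ^ t" by (induction t) auto
  finally show ?thesis .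
qed

lemma set_decode_bounded: "u < 2 ^ t \<Longrightarrow> i \<in> set_decode u \<Longrightarrow> i < t"
proof (rule ccontr)
  assume "u < 2 ^ t" "i \<in> set_decode u" "\<not> i < t"
  moreover from this have "(2::nat) ^ t \<le> 2 ^ i" by (intro power_increasing) auto
  ultimately have "u div 2 ^ i = 0" by (intro div_less) linarith
  with \<open>i \<in> set_decode u\<close> show False by (simp add: set_decode_def)
qed

lemma oracle_code_eq_iff:
  assumes "u < 2 ^ t"
  shows "oracle_code X t = u \<longleftrightarrow> (\<forall>i<t. X i \<longleftrightarrow> i \<in> set_decode u)"
proof -
  have "oracle_code X t = u \<longleftrightarrow> set_decode (oracle_code X t) = set_decode u"
    by (metis set_decode_inverse)
  then show ?thesis using set_decode_bounded[OF assms] by auto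
qed

lemma cylinder:
  assumes "u < 2 ^ t"
  shows "{X. oracle_code X t = u} \<in> sets fair_coin_measure"
    and "measure fair_coin_measure {X. oracle_code X t = u} = 1 / 2 ^ t"
proof -
  let ?B = "\<lambda>i. {i \<in> set_decode u}"
  let ?E = "prod_emb UNIV (\<lambda>_. measure_pmf (bernoulli_pmf (1/2))) {..<t} (Pi\<^sub>E {..<t} ?B)"
  have eq: "{X. oracle_code X t = u} = ?E"
    by (rule set_eqI) (simp add: oracle_code_eq_iff[OF assms] prod_emb_iff PiE_iff Ball_def)
  show "{X. oracle_code X t = u} \<in> sets fair_coin_measure"
    unfolding eq fair_coin_measure_def by (intro sets_PiM_I) auto
  have "measure fair_coin_measure ?E = (\<Prod>i<t. measure (measure_pmf (bernoulli_pmf (1/2))) (?B i))"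
    unfolding fair_coin_measure_def by (intro fair_coin.measure_PiM_emb) auto
  also have "\<dots> = 1 / 2 ^ t"
    by (simp add: measure_pmf_single power_one_over)
  finally show "measure fair_coin_measure {X. oracle_code X t = u} = 1 / 2 ^ t" unfolding eq .
qed

text \<open>The \<open>2 ^ t\<close> initial segments of length \<open>t\<close> are equally likely.
  Hence the counts in \<open>light\<close> and \<open>fires\<close>, which can be compared
  effectively, are probabilities.\<close>

lemma oracle_event:
  shows sets_oracle_event [measurable]: "{X. P (oracle_code X t)} \<in> sets fair_coin_measure"
    and prob_oracle_event:
      "coin.prob {X. P (oracle_code X t)} = real (\<Sum>u<2 ^ t. of_bool (P u)) / 2 ^ t"
proof -
  let ?U = "{u\<in>{..<2 ^ t}. P u}"
  have eq: "{X. P (oracle_code X t)} = (\<Union>u\<in>?U. {X. oracle_code X t = u})"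
    using oracle_code_less by auto
  show "{X. P (oracle_code X t)} \<in> sets fair_coin_measure"
    unfolding eq by (intro sets.finite_UN cylinder) auto
  have "coin.prob (\<Union>u\<in>?U. {X. oracle_code X t = u}) = (\<Sum>u\<in>?U. coin.prob {X. oracle_code X t = u})"
    by (intro coin.finite_measure_finite_Union) (auto simp: disjoint_family_on_def intro!: cylinder)
  also have "\<dots> = (\<Sum>u\<in>?U. 1 / 2 ^ t)"
    by (intro sum.cong cylinder) auto
  also have "\<dots> = real (\<Sum>u<2 ^ t. of_bool (P u)) / 2 ^ t"
    by (simp add: Int_def)
  finally show "coin.prob {X. P (oracle_code X t)} = real (\<Sum>u<2 ^ t. of_bool (P u)) / 2 ^ t"
    unfolding eq .
qed

section \<open>The bad nodes of the trees\<close>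

text \<open>A node is the pair of its tree and the code of its path, with 0 for the root and the
  last move stored outermost. The root is its own \<open>par\<close>, and its \<open>idx\<close> has
  no meaning.\<close>

definition kid :: "nat \<Rightarrow> nat \<Rightarrow> nat" where
  "kid v i = pair (pfst v) (Suc (pair (psnd v) i))"

definition par :: "nat \<Rightarrow> nat" where
  "par v = (if psnd v = 0 then v else pair (pfst v) (pfst (psnd v - 1)))"

definition idx :: "nat \<Rightarrow> nat" where
  "idx v = psnd (psnd v - 1)"

lemma kid_simps [simp]: "par (kid v i) = v" "idx (kid v i) = i" "pfst (kid v i) = pfst v"
    "psnd (kid v i) \<noteq> 0"
  by (simp_all add: kid_def par_def idx_def)

lemma kid_par_idx: "psnd v \<noteq> 0 \<Longrightarrow> kid (par v) (idx v) = v"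
  by (simp add: kid_def par_def idx_def)

lemma kid_inj [simp]: "kid v i = kid w j \<longleftrightarrow> v = w \<and> i = j"
  by (metis kid_simps(1,2))

text \<open>
  The number \<open>n\<close> of a tree codes the data of its opponent: a program \<open>pfst n\<close>, a clopen set given
  by \<open>level n\<close> and \<open>region n\<close>, and a threshold.
\<close>

definition level :: "nat \<Rightarrow> nat" where "level n = pfst (psnd n)"
definition region :: "nat \<Rightarrow> nat" where "region n = pfst (psnd (psnd n))"
definition threshold :: "nat \<Rightarrow> nat" where "threshold n = psnd (psnd (psnd n))"

text \<open>A reading program answers a node with the index of the kid on its path; the answer
  counts as a visit to that kid. So an oracle visits at most one kid of each node.\<close>

definition visits :: "nat \<Rightarrow> nat \<Rightarrow> nat \<Rightarrow> nat \<Rightarrow> bool" where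
  "visits n t u v \<longleftrightarrow> psnd v \<noteq> 0 \<and> computes t u (pfst n) (par v) (idx v)"

text \<open>The measure of the visiting oracles is compared with
  \<open>1 / 2 ^ (par v + level n)\<close>. The summand \<open>par v\<close> makes these bounds
  summable over all parents, and \<open>level n\<close> makes their sum small.\<close>

definition light :: "nat \<Rightarrow> nat \<Rightarrow> nat \<Rightarrow> bool" where
  "light n t v \<longleftrightarrow> (\<Sum>u<2 ^ t. of_bool (visits n t u v)) * 2 ^ (par v + level n) \<le> (2::nat) ^ t"

text \<open>
  Of every node one kid is guarded, i.e. protected from becoming bad. Since it is light, the guards
  together cost the opponent little measure.
\<close>

definition guarded :: "nat \<Rightarrow> nat \<Rightarrow> nat \<Rightarrow> nat \<Rightarrow> bool" where
  "guarded n t b v \<longleftrightarrow> psnd v \<noteq> 0 \<and> v \<notin> set_decode b \<and> light n t v \<and>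
     (\<forall>i<idx v. kid (par v) i \<in> set_decode b \<or> \<not> light n t (kid (par v) i))"

text \<open>The root counts as reached without any answer of the program; this catches oracles whose
  path ends at the root. The bound \<open>v < t\<close> is the one under which nodes become bad when
  the opponent acts.\<close>

definition exposed :: "nat \<Rightarrow> nat \<Rightarrow> nat \<Rightarrow> nat \<Rightarrow> bool" where
  "exposed n t b u \<longleftrightarrow> u mod 2 ^ level n \<in> set_decode (region n) \<and>
     (\<exists>v<t. pfst v = n \<and> v \<notin> set_decode b \<and> \<not> guarded n t b v \<and> (psnd v = 0 \<or> visits n t u v))"

text \<open>Compares the measure of the exposed oracles with
  \<open>threshold n / 2 ^ level n\<close>, multiplied out so as to stay within the natural
  numbers.\<close>

definition fires :: "nat \<Rightarrow> nat \<Rightarrow> nat \<Rightarrow> bool" where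
  "fires n t b \<longleftrightarrow>
     threshold n * 2 ^ t \<le> (\<Sum>u<2 ^ t. of_bool (exposed n t b u)) * (2::nat) ^ level n"

definition bad :: "nat \<Rightarrow> nat \<Rightarrow> nat" where
  "bad n t = rec_nat 0 (\<lambda>t b. if fires n t b
     then set_encode {v. v < t \<and> pfst v = n \<and> \<not> guarded n t b v} else b) t"

definition bad_nodes :: "nat set" where
  "bad_nodes = {v. \<exists>t. v \<in> set_decode (bad (pfst v) t)}"

lemma rc_kid [rec_intros]:
  "recursive_in A f \<Longrightarrow> recursive_in A g \<Longrightarrow> recursive_in A (\<lambda>x. kid (f x) (g x))"
  unfolding kid_def by (intro rec_intros)

lemma rc_par [rec_intros]: "recursive_in A f \<Longrightarrow> recursive_in A (\<lambda>x. par (f x))"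
  unfolding par_def by (intro rec_intros)

lemma rc_visits [rec_intros]:
  "recursive_in A f \<Longrightarrow> recursive_in A g \<Longrightarrow> recursive_in A h \<Longrightarrow> recursive_in A k \<Longrightarrow>
    decidable A (\<lambda>x. visits (f x) (g x) (h x) (k x))"
  unfolding visits_def idx_def by (intro rec_intros)

lemma rc_light [rec_intros]:
  assumes "recursive_in A f" "recursive_in A g" "recursive_in A h"
  shows "decidable A (\<lambda>x. light (f x) (g x) (h x))"
  unfolding light_def level_def
  by (intro rec_intros rc_comp[OF assms(1)] rc_comp[OF assms(2)] rc_comp[OF assms(3)] assms)

lemma rc_guarded [rec_intros]:
  assumes "recursive_in A f" "recursive_in A g" "recursive_in A h" "recursive_in A k"
  shows "decidable A (\<lambda>x. guarded (f x) (g x) (h x) (k x))"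
  unfolding guarded_def idx_def
  by (intro rec_intros rc_comp[OF assms(1)] rc_comp[OF assms(2)] rc_comp[OF assms(3)]
      rc_comp[OF assms(4)] assms)

lemma rc_fires [rec_intros]:
  assumes "recursive_in A f" "recursive_in A g" "recursive_in A h"
  shows "decidable A (\<lambda>x. fires (f x) (g x) (h x))"
  unfolding fires_def exposed_def level_def region_def threshold_def
  by (intro rec_intros rc_comp[OF assms(1)] rc_comp[OF assms(2)] rc_comp[OF assms(3)] assms)

lemma rc_bad [rec_intros]:
  assumes "recursive_in A f" "recursive_in A g"
  shows "recursive_in A (\<lambda>x. bad (f x) (g x))"
  unfolding bad_def
  by (intro rec_intros rc_comp[OF assms(1)] rc_comp[OF assms(2)] assms)

lemma bad_0: "set_decode (bad n 0) = {}"
  by (simp add: bad_def)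

lemma bad_Suc: "set_decode (bad n (Suc t)) =
    (if fires n t (bad n t) then {v. v < t \<and> pfst v = n \<and> \<not> guarded n t (bad n t) v}
     else set_decode (bad n t))"
  by (simp add: bad_def set_encode_inverse)

lemma in_badD: "v \<in> set_decode (bad n t) \<Longrightarrow> v < t \<and> pfst v = n"
  by (induction t) (auto simp: bad_0 bad_Suc less_Suc_eq split: if_splits)

text \<open>Firing overwrites the set but loses nothing: an old bad node is below \<open>t\<close>,
  and being bad it is not guarded.\<close>

lemma bad_Suc_mono: "set_decode (bad n t) \<subseteq> set_decode (bad n (Suc t))"
  using in_badD by (auto simp: bad_Suc guarded_def)

lemma bad_mono: "t \<le> t' \<Longrightarrow> set_decode (bad n t) \<subseteq> set_decode (bad n t')"
  using lift_Suc_mono_le[of "\<lambda>t. set_decode (bad n t)"] bad_Suc_mono by blast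

lemma light_iff:
  "light n t v \<longleftrightarrow> coin.prob {X. visits n t (oracle_code X t) v} \<le> 1 / 2 ^ (par v + level n)"
proof -
  have "light n t v \<longleftrightarrow> real (\<Sum>u<2 ^ t. of_bool (visits n t u v)) * 2 ^ (par v + level n) \<le> 2 ^ t"
    unfolding light_def
    by (metis (no_types, lifting) of_nat_le_iff of_nat_mult of_nat_numeral of_nat_power)
  then show ?thesis
    unfolding prob_oracle_event[of "\<lambda>u. visits n t u v" t] by (simp add: field_simps)
qed

lemma visits_mono: "visits n t (oracle_code X t) v \<Longrightarrow> t \<le> t' \<Longrightarrow> visits n t' (oracle_code X t') v"
  unfolding visits_def using computes_mono by blast

text \<open>Visits accumulate with the stage, so lightness can be lost but never regained.\<close>

lemma light_antimono: "light n t' v \<Longrightarrow> t \<le> t' \<Longrightarrow> light n t v"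
  unfolding light_iff
  by (erule order.trans[rotated], intro coin.finite_measure_mono sets_oracle_event)
    (auto intro: visits_mono)

definition visited :: "nat \<Rightarrow> nat \<Rightarrow> (nat \<Rightarrow> bool) set" where
  "visited n v = {X. psnd v \<noteq> 0 \<and> eval {i. X i} (dec (pfst n)) [par v] (idx v)}"

lemma visited_iff: "visited n v = (\<Union>t. {X. visits n t (oracle_code X t) v})"
  by (auto simp: visited_def visits_def eval_iff_computes)

lemma sets_visited [measurable]: "visited n v \<in> sets fair_coin_measure"
  unfolding visited_iff by measurable

lemma disjoint_visited: "i \<noteq> j \<Longrightarrow> visited n (kid v i) \<inter> visited n (kid v j) = {}"
  by (auto simp: visited_def dest: eval_deterministic)

text \<open>Each kid that is ever heavy takes measure more than \<open>1 / 2 ^ (v + level n)\<close>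
  from the unit total, and determinism of evaluation makes the sets of oracles visiting different
  kids disjoint.\<close>

lemma finite_heavy: "finite {i. \<exists>t. \<not> light n t (kid v i)}"
proof (rule ccontr)
  let ?H = "{i. \<exists>t. \<not> light n t (kid v i)}" and ?N = "(2::nat) ^ (v + level n)"
  assume "infinite ?H"
  then obtain F where F: "F \<subseteq> ?H" "finite F" "card F = ?N" by (metis infinite_arbitrarily_large)
  have heavy: "1 / ?N < coin.prob (visited n (kid v i))" if "i \<in> ?H" for i
  proof -
    obtain t where "\<not> light n t (kid v i)" using \<open>i \<in> ?H\<close> by auto
    then have "1 / ?N < coin.prob {X. visits n t (oracle_code X t) (kid v i)}"
      by (simp add: light_iff)
    also have "\<dots> \<le> coin.prob (visited n (kid v i))"
      by (intro coin.finite_measure_mono sets_visited) (auto simp: visited_iff)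
    finally show ?thesis .
  qed
  have "1 = (\<Sum>i\<in>F. 1 / ?N)" using F(3) by simp
  also have "\<dots> < (\<Sum>i\<in>F. coin.prob (visited n (kid v i)))"
    using F heavy by (intro sum_strict_mono) auto
  also have "\<dots> = coin.prob (\<Union>i\<in>F. visited n (kid v i))"
    using F(2) disjoint_visited
    by (intro coin.finite_measure_finite_Union[symmetric]) (auto simp: disjoint_family_on_def)
  also have "\<dots> \<le> 1" by (rule coin.prob_le_1)
  finally show False by simp
qed

text \<open>
  Once all the finitely many heavy kids have become heavy, the guard of a node never moves again.
\<close>

lemma ex_good_kid: "\<exists>i. kid v i \<notin> bad_nodes"
proof -
  define n where "n = pfst v"
  define H where "H = {i. \<exists>t. \<not> light n t (kid v i)}"
  have finH: "finite H" unfolding H_def by (rule finite_heavy)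
  have "\<forall>i\<in>H. \<exists>t. \<not> light n t (kid v i)" by (simp add: H_def)
  from bchoice[OF this] obtain s where s: "\<forall>i\<in>H. \<not> light n (s i) (kid v i)" by (elim exE)
  obtain t0 where t0: "\<And>i. i \<in> H \<Longrightarrow> s i \<le> t0"
    using finite_nat_set_iff_bounded_le[of "s ` H"] finH by auto
  have heavy: "\<not> light n t (kid v i)" if "i \<in> H" "t0 \<le> t" for i t
    using bspec[OF s that(1)] t0[OF that(1)] that(2) light_antimono[of n t "kid v i" "s i"] by auto
  have "finite {i. kid v i \<in> set_decode (bad n t0)}"
    by (rule finite_imageD[of "kid v"])
      (auto intro: finite_subset[OF _ finite_set_decode[of "bad n t0"]] inj_onI)
  then have "\<exists>i. i \<notin> H \<and> kid v i \<notin> set_decode (bad n t0)"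
    using finH ex_new_if_finite[of "H \<union> {i. kid v i \<in> set_decode (bad n t0)}"] by auto
  note ex = this
  define i where "i = (LEAST i. i \<notin> H \<and> kid v i \<notin> set_decode (bad n t0))"
  have i: "i \<notin> H" "kid v i \<notin> set_decode (bad n t0)"
    using LeastI_ex[OF ex] unfolding i_def by blast+
  have least: "j \<in> H \<or> kid v j \<in> set_decode (bad n t0)" if "j < i" for j
    using not_less_Least[OF that[unfolded i_def]] by blast
  have "kid v i \<notin> set_decode (bad n t)" if "t0 \<le> t" for t
    using that
  proof (induction rule: dec_induct)
    case (step t)
    have "guarded n t (bad n t) (kid v i)"
      unfolding guarded_def
    proof (intro conjI allI impI)
      show "light n t (kid v i)" using i(1) by (simp add: H_def)
      fix j assume "j < idx (kid v i)"
      then have "j < i" by simp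
      from least[OF this] show "kid (par (kid v i)) j \<in> set_decode (bad n t) \<or>
          \<not> light n t (kid (par (kid v i)) j)"
        using heavy[of j t] subsetD[OF bad_mono[of t0 t n]] step.hyps by auto
    qed (use step.IH in simp_all)
    then show ?case using step.IH by (auto simp: bad_Suc)
  qed (rule i(2))
  then have "kid v i \<notin> set_decode (bad n t)" for t
    using bad_mono[of t t0 n] i(2) by (cases "t0 \<le> t") auto
  then show ?thesis by (auto simp: bad_nodes_def n_def)
qed

section \<open>Readers of the trees are null\<close>

lemma oracle_code_mod: "l \<le> t \<Longrightarrow> oracle_code X t mod 2 ^ l = oracle_code X l"
proof -
  assume "l \<le> t"
  have mem: "i \<in> set_decode x \<longleftrightarrow> bit x i" for x i :: nat by (simp add: set_decode_def bit_iff_odd)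
  have "i \<in> set_decode (oracle_code X t mod 2 ^ l) \<longleftrightarrow> i < l \<and> i \<in> set_decode (oracle_code X t)" for i
    unfolding mem by (simp add: take_bit_eq_mod[symmetric] bit_take_bit_iff)
  then have "set_decode (oracle_code X t mod 2 ^ l) = set_decode (oracle_code X l)"
    using \<open>l \<le> t\<close> by (intro set_eqI) (simp only: set_decode_oracle_code mem_Collect_eq, linarith)
  from arg_cong[OF this, of set_encode] show ?thesis by (simp only: set_decode_inverse)
qed

section \<open>Approximation of measurable sets by clopen sets\<close>

text \<open>Closeness is demanded at all large levels, so that finitely many sets can be
  approximated at a common level and the level can be raised later to make the guards cheap.\<close>

definition approximable :: "(nat \<Rightarrow> bool) set \<Rightarrow> bool" where
  "approximable W \<longleftrightarrow> (\<forall>\<epsilon>>0. \<exists>l0. \<forall>l\<ge>l0. \<exists>K.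
     coin.prob ((W - {X. oracle_code X l \<in> K}) \<union> ({X. oracle_code X l \<in> K} - W)) < \<epsilon>)"

text \<open>A finite part of the union carries all but half of the permitted error, and the sets of
  that part share the other half at one common level.\<close>

lemma approximable_UN:
  fixes W :: "nat \<Rightarrow> (nat \<Rightarrow> bool) set"
  assumes W: "\<And>n. W n \<in> sets fair_coin_measure" and ap: "\<And>n. approximable (W n)"
  shows "approximable (\<Union>n. W n)"
  unfolding approximable_def
proof (intro allI impI)
  fix \<epsilon> :: real assume "0 < \<epsilon>"
  define V where "V N = (\<Union>n<N. W n)" for N
  have V: "V N \<in> sets fair_coin_measure" for N unfolding V_def using W by auto
  have U: "(\<Union>n. W n) \<in> sets fair_coin_measure" using W by auto
  have "incseq V" unfolding V_def by (intro monoI UN_mono) auto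
  then have "(\<lambda>N. coin.prob (V N)) \<longlonglongrightarrow> coin.prob (\<Union>N. V N)"
    using V by (intro coin.finite_Lim_measure_incseq) auto
  moreover have "(\<Union>N. V N) = (\<Union>n. W n)" unfolding V_def by auto
  ultimately have "(\<lambda>N. coin.prob (V N)) \<longlonglongrightarrow> coin.prob (\<Union>n. W n)" by simp
  then have "\<forall>\<^sub>F N in sequentially. coin.prob (\<Union>n. W n) - \<epsilon> / 2 < coin.prob (V N)"
    using \<open>0 < \<epsilon>\<close> by (intro order_tendstoD(1)) auto
  then obtain N where N: "coin.prob (\<Union>n. W n) - \<epsilon> / 2 < coin.prob (V N)"
    using eventually_happens'[OF sequentially_bot] by blast
  have "coin.prob ((\<Union>n. W n) - V N) = coin.prob (\<Union>n. W n) - coin.prob (V N)"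
    using V U by (intro coin.finite_measure_Diff) (auto simp: V_def)
  with N have tail: "coin.prob ((\<Union>n. W n) - V N) < \<epsilon> / 2" by simp
  \<comment> \<open>\<open>Suc N\<close> instead of \<open>N\<close> avoids a division by zero; the
    \<open>N\<close> errors still sum to at most \<open>\<epsilon> / 2\<close>.\<close>
  define \<delta> where "\<delta> = \<epsilon> / (2 * real (Suc N))"
  have "0 < \<delta>" using \<open>0 < \<epsilon>\<close> by (simp add: \<delta>_def)
  then have "\<forall>n. \<exists>l0. \<forall>l\<ge>l0. \<exists>K.
     coin.prob ((W n - {X. oracle_code X l \<in> K}) \<union> ({X. oracle_code X l \<in> K} - W n)) < \<delta>"
    using ap unfolding approximable_def by blast
  then obtain L where L: "\<forall>n. \<forall>l\<ge>L n. \<exists>K.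
     coin.prob ((W n - {X. oracle_code X l \<in> K}) \<union> ({X. oracle_code X l \<in> K} - W n)) < \<delta>"
    by (rule choice[THEN exE])
  obtain l0 where l0: "\<And>n. n < N \<Longrightarrow> L n \<le> l0"
    using finite_nat_set_iff_bounded_le[of "L ` {..<N}"] by auto
  show "\<exists>l0. \<forall>l\<ge>l0. \<exists>K. coin.prob ((\<Union>n. W n) - {X. oracle_code X l \<in> K} \<union>
      ({X. oracle_code X l \<in> K} - (\<Union>n. W n))) < \<epsilon>"
  proof (intro exI[of _ l0] allI impI)
    fix l assume "l0 \<le> l"
    then have "\<forall>n. \<exists>K. n < N \<longrightarrow>
       coin.prob ((W n - {X. oracle_code X l \<in> K}) \<union> ({X. oracle_code X l \<in> K} - W n)) < \<delta>"
      using L l0 by (meson le_trans)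
    then obtain K where K: "\<forall>n. n < N \<longrightarrow>
       coin.prob ((W n - {X. oracle_code X l \<in> K n}) \<union> ({X. oracle_code X l \<in> K n} - W n)) < \<delta>"
      by (rule choice[THEN exE])
    define D where "D n = (W n - {X. oracle_code X l \<in> K n}) \<union> ({X. oracle_code X l \<in> K n} - W n)" for n
    have D: "D n \<in> sets fair_coin_measure" for n unfolding D_def using W by auto
    have "coin.prob ((\<Union>n. W n) - {X. oracle_code X l \<in> (\<Union>n<N. K n)} \<union>
        ({X. oracle_code X l \<in> (\<Union>n<N. K n)} - (\<Union>n. W n)))
      \<le> coin.prob (((\<Union>n. W n) - V N) \<union> (\<Union>n<N. D n))"
      using U V D by (intro coin.finite_measure_mono) (auto simp: V_def D_def)
    also have "\<dots> \<le> coin.prob ((\<Union>n. W n) - V N) + coin.prob (\<Union>n<N. D n)"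
      using U V D by (intro measure_Un_le) auto
    also have "coin.prob (\<Union>n<N. D n) \<le> (\<Sum>n<N. coin.prob (D n))"
      using D by (intro coin.finite_measure_subadditive_finite) auto
    also have "\<dots> \<le> (\<Sum>n<N. \<delta>)"
      using K by (intro sum_mono) (auto simp: D_def intro: less_imp_le)
    also have "\<dots> \<le> \<epsilon> / 2"
      using \<open>0 < \<epsilon>\<close> by (simp add: \<delta>_def field_simps)
    finally show "\<exists>K. coin.prob ((\<Union>n. W n) - {X. oracle_code X l \<in> K} \<union>
        ({X. oracle_code X l \<in> K} - (\<Union>n. W n))) < \<epsilon>"
      using tail by (intro exI[of _ "\<Union>n<N. K n"]) simp
  qed
qed

lemma sets_fair_coin_approximable:
  assumes "W \<in> sets fair_coin_measure"
  shows "approximable W"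
proof -
  let ?G = "{{f. f i \<in> A} | (i::nat) (A::bool set). True}"
  have eq: "sets fair_coin_measure = sigma_sets UNIV ?G"
    unfolding fair_coin_measure_def sets_PiM_single by (simp add: PiE_UNIV_domain)
  from assms have "W \<in> sigma_sets UNIV ?G" unfolding eq .
  then show ?thesis
  proof induction
    case (Basic W)
    then obtain i A where W: "W = {f. f i \<in> A}" by auto
    have "W = {X. oracle_code X l \<in> {u. (i \<in> set_decode u) \<in> A}}" if "Suc i \<le> l" for l
      using that by (auto simp: W)
    then have e: "\<exists>K. (W - {X. oracle_code X l \<in> K}) \<union> ({X. oracle_code X l \<in> K} - W) = {}"
      if "Suc i \<le> l" for l
      using that by blast
    then show ?case unfolding approximable_def
      by (intro allI impI exI[of _ "Suc i"]) (metis measure_empty)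
  next
    case Empty
    show ?case unfolding approximable_def
      by (intro allI impI exI[of _ 0] exI[of _ "{}"]) simp
  next
    case (Compl W)
    have "((UNIV - W) - {X. oracle_code X l \<in> - K}) \<union> ({X. oracle_code X l \<in> - K} - (UNIV - W))
       = (W - {X. oracle_code X l \<in> K}) \<union> ({X. oracle_code X l \<in> K} - W)" for l K
      by auto
    then show ?case using Compl.IH unfolding approximable_def by metis
  next
    case (Union W)
    then show ?case by (intro approximable_UN) (auto simp: eq)
  qed
qed

text \<open>Iterating \<open>par\<close> without bound is harmless since it fixes the root; the set
  is the finite path from the root to \<open>v\<close>.\<close>

definition anc :: "nat \<Rightarrow> nat set" where
  "anc v = range (\<lambda>t. (par ^^ t) v)"

lemma self_in_anc: "v \<in> anc v"
  unfolding anc_def by (rule range_eqI[of _ _ 0]) simp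

lemma pfst_par [simp]: "pfst (par v) = pfst v"
  by (simp add: par_def)

lemma par_le: "par v \<le> v"
proof (cases "psnd v = 0")
  case False
  have "pfst (psnd v - 1) \<le> psnd v" using pfst_le[of "psnd v - 1"] by simp
  then have "par v \<le> pair (pfst v) (psnd v)"
    unfolding par_def using False
    by (simp del: pair_pfst_psnd add: prod_encode_triangle triangle_mono)
  then show ?thesis by simp
qed (simp add: par_def)

lemma anc_le: "u \<in> anc v \<Longrightarrow> u \<le> v"
proof -
  have "(par ^^ t) v \<le> v" for t by (induction t) (auto intro: order.trans[OF par_le])
  then show "u \<in> anc v \<Longrightarrow> u \<le> v" by (auto simp: anc_def)
qed

lemma finite_anc: "finite (anc v)"
  using anc_le by (intro finite_subset[of "anc v" "{..v}"] subsetI) simp_all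

section \<open>The set of successful oracles\<close>

text \<open>The program is uniform in the tree, so the tree may be chosen after it. It diverges at
  the end \<open>w\<close> of the path, because no kid of \<open>w\<close> is an ancestor of
  \<open>w\<close>; the opponent exploits that this path is finite.\<close>

definition readers :: "nat \<Rightarrow> (nat \<Rightarrow> bool) set" where
  "readers e = {X. \<forall>n. \<exists>w. pfst w = n \<and> w \<notin> bad_nodes \<and>
     (\<forall>D i. pfst D = n \<longrightarrow> (eval {i. X i} (dec e) [D] i \<longleftrightarrow> kid D i \<in> anc w))}"

lemma pred_eval [measurable]: "Measurable.pred fair_coin_measure (\<lambda>X. eval {i. X i} (dec e) [x] y)"
proof -
  have "{X. eval {i. X i} (dec e) [x] y} = (\<Union>t. {X. computes t (oracle_code X t) e x y})"
    by (auto simp: eval_iff_computes)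
  also have "\<dots> \<in> sets fair_coin_measure"
    by (intro sets.countable_UN' sets_oracle_event) auto
  finally show ?thesis by (simp add: pred_def)
qed

lemma sets_readers [measurable]: "readers e \<in> sets fair_coin_measure"
proof -
  have "{X \<in> space fair_coin_measure. \<forall>n. \<exists>w. pfst w = n \<and> w \<notin> bad_nodes \<and>
     (\<forall>D i. pfst D = n \<longrightarrow> (eval {i. X i} (dec e) [D] i \<longleftrightarrow> kid D i \<in> anc w))}
     \<in> sets fair_coin_measure"
    by measurable
  then show ?thesis by (simp add: readers_def)
qed

lemma reader_path:
  assumes "X \<in> readers (pfst n)"
  shows "\<exists>w. pfst w = n \<and> w \<notin> bad_nodes \<and>
    (\<forall>v. pfst v = n \<longrightarrow> (X \<in> visited n v \<longleftrightarrow> psnd v \<noteq> 0 \<and> v \<in> anc w))"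
proof -
  have "\<exists>w. pfst w = n \<and> w \<notin> bad_nodes \<and>
      (\<forall>D i. pfst D = n \<longrightarrow> (eval {i. X i} (dec (pfst n)) [D] i \<longleftrightarrow> kid D i \<in> anc w))"
    using assms unfolding readers_def by simp
  then obtain w where w: "pfst w = n" "w \<notin> bad_nodes"
    "\<forall>D i. pfst D = n \<longrightarrow> (eval {i. X i} (dec (pfst n)) [D] i \<longleftrightarrow> kid D i \<in> anc w)"
    by (elim exE conjE)
  then show ?thesis
    by (intro exI[of _ w]) (auto simp: visited_def kid_par_idx)
qed

lemma guarded_unique:
  assumes "guarded n t b (kid v i)" "guarded n t b (kid v j)" shows "i = j"
proof -
  have "\<not> i < j" "\<not> j < i" using assms by (auto simp: guarded_def)
  then show ?thesis by simp
qed

text \<open>A parent \<open>v\<close> has at most one guard, which costs at most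
  \<open>1 / 2 ^ (v + level n)\<close>; the geometric series over all \<open>v\<close> gives the
  factor 2.\<close>

lemma prob_guarded:
  "coin.prob {X. \<exists>v. guarded n t b v \<and> visits n t (oracle_code X t) v} \<le> 2 / 2 ^ level n"
proof -
  define A where "A v = {X. \<exists>i. guarded n t b (kid v i) \<and> visits n t (oracle_code X t) (kid v i)}" for v
  have A: "A v \<in> sets fair_coin_measure" for v
    unfolding A_def by (rule sets_oracle_event)
  have le: "coin.prob (A v) \<le> 1 / 2 ^ level n * (1 / 2) ^ v" for v
  proof (cases "\<exists>i. guarded n t b (kid v i)")
    case True
    then obtain i where i: "guarded n t b (kid v i)" ..
    then have "A v = {X. visits n t (oracle_code X t) (kid v i)}"
      unfolding A_def using guarded_unique by blast
    moreover have "light n t (kid v i)" using i by (simp add: guarded_def)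
    ultimately show ?thesis by (simp add: light_iff power_add power_one_over field_simps)
  next
    case False
    then have "A v = {}" unfolding A_def by auto
    then show ?thesis by simp
  qed
  have s: "(\<lambda>v. 1 / 2 ^ level n * (1 / 2) ^ v) sums (1 / 2 ^ level n * (1 / (1 - 1 / 2)) :: real)"
    by (intro sums_mult geometric_sums) simp
  have sm: "summable (\<lambda>v. coin.prob (A v))"
    by (rule summable_comparison_test'[OF sums_summable[OF s]]) (use le in auto)
  have "{X. \<exists>v. guarded n t b v \<and> visits n t (oracle_code X t) v} = (\<Union>v. A v)"
  proof (intro set_eqI iffI)
    fix X assume "X \<in> {X. \<exists>v. guarded n t b v \<and> visits n t (oracle_code X t) v}"
    then obtain v where v: "guarded n t b v" "visits n t (oracle_code X t) v" by auto
    then have "kid (par v) (idx v) = v" by (intro kid_par_idx) (simp add: guarded_def)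
    with v have "X \<in> A (par v)" unfolding A_def by (intro CollectI exI[of _ "idx v"]) simp
    then show "X \<in> (\<Union>v. A v)" by blast
  qed (auto simp: A_def)
  then have "coin.prob {X. \<exists>v. guarded n t b v \<and> visits n t (oracle_code X t) v} = coin.prob (\<Union>v. A v)"
    by simp
  also have "\<dots> \<le> (\<Sum>v. coin.prob (A v))"
    using A sm by (intro coin.finite_measure_subadditive_countably) auto
  also have "\<dots> \<le> 1 / 2 ^ level n * (1 / (1 - 1 / 2))"
    using suminf_le[OF le sm sums_summable[OF s]] sums_unique[OF s] by simp
  finally show ?thesis by simp
qed

lemma fires_iff:
  "fires n t b \<longleftrightarrow> real (threshold n) / 2 ^ level n \<le> coin.prob {X. exposed n t b (oracle_code X t)}"
proof -
  have "fires n t b \<longleftrightarrow> real (threshold n) * 2 ^ t \<le>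
      real (\<Sum>u<2 ^ t. of_bool (exposed n t b u)) * 2 ^ level n"
    unfolding fires_def of_nat_le_iff[where 'a = real, symmetric]
    by (simp only: of_nat_mult of_nat_power of_nat_numeral)
  then show ?thesis
    unfolding prob_oracle_event[of "\<lambda>u. exposed n t b u" t] by (simp add: field_simps)
qed

lemma null_readers: "coin.prob (readers e) = 0"
proof (rule ccontr)
  define w where "w = coin.prob (readers e)"
  assume "coin.prob (readers e) \<noteq> 0"
  then have w: "0 < w" by (simp add: w_def zero_less_measure_iff)
  obtain l0 where l0: "\<And>l. l0 \<le> l \<Longrightarrow> \<exists>K. coin.prob ((readers e - {X. oracle_code X l \<in> K}) \<union>
      ({X. oracle_code X l \<in> K} - readers e)) < w / 4"
    using sets_fair_coin_approximable[OF sets_readers, of e] w unfolding approximable_def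
    by (meson divide_pos_pos zero_less_numeral)
  \<comment> \<open>Rounding the threshold will cost \<open>1 / 2 ^ l\<close> and the guards
    \<open>2 / 2 ^ l\<close>; together this is to be at most \<open>3 * w / 8\<close>.\<close>
  obtain l1 where l1: "(1 / 2) ^ l1 < w / 8"
    using real_arch_pow_inv[of "w / 8" "1 / 2"] w by auto
  define l where "l = max l0 l1"
  have "(1 / 2 :: real) ^ l \<le> (1 / 2) ^ l1" by (intro power_decreasing) (auto simp: l_def)
  with l1 have l: "1 / 2 ^ l \<le> w / 8" by (simp add: power_one_over)
  obtain K where K: "coin.prob ((readers e - {X. oracle_code X l \<in> K}) \<union>
      ({X. oracle_code X l \<in> K} - readers e)) < w / 4"
    using l0[of l] by (auto simp: l_def)
  define C where "C = {X. oracle_code X l \<in> K}"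
  have C [measurable]: "C \<in> sets fair_coin_measure" unfolding C_def by (rule sets_oracle_event)
  have W: "readers e \<in> sets fair_coin_measure" by measurable
  have KC: "coin.prob ((readers e - C) \<union> (C - readers e)) < w / 4" using K by (simp add: C_def)
  have "coin.prob (readers e - C) \<le> coin.prob ((readers e - C) \<union> (C - readers e))"
    using C W by (intro coin.finite_measure_mono) auto
  moreover have "coin.prob (readers e - C) = w - coin.prob (readers e \<inter> C)"
    unfolding w_def using C W by (intro coin.finite_measure_Diff') auto
  ultimately have inside: "3 * w / 4 < coin.prob (readers e \<inter> C)" using KC by simp
  have "coin.prob (C - readers e) \<le> coin.prob ((readers e - C) \<union> (C - readers e))"
    using C W by (intro coin.finite_measure_mono) auto
  with KC have outside: "coin.prob (C - readers e) < w / 4" by simp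
  \<comment> \<open>The threshold \<open>w / 4\<close>, rounded up to a multiple of
    \<open>1 / 2 ^ l\<close>, the form in which a tree number can carry it.\<close>
  define a where "a = nat \<lceil>2 ^ l * w / 4\<rceil>"
  define q where "q = real a / 2 ^ l"
  have "2 ^ l * w / 4 \<le> real a" "real a \<le> 2 ^ l * w / 4 + 1"
    unfolding a_def using w by (auto simp: of_nat_nat ceiling_correct intro: less_imp_le)
  then have q: "w / 4 \<le> q" "q \<le> w / 4 + 1 / 2 ^ l"
    unfolding q_def by (simp_all add: field_simps)
  define n where "n = pair e (pair l (pair (set_encode {u\<in>K. u < 2 ^ l}) a))"
  have n: "pfst n = e" "level n = l" "threshold n = a" "set_decode (region n) = {u\<in>K. u < 2 ^ l}"
    by (simp_all add: n_def level_def threshold_def region_def set_encode_inverse)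
  define B where "B t = set_decode (bad n t)" for t
  define E where "E t = {X. exposed n t (bad n t) (oracle_code X t)}" for t
  define G where "G t = {X. \<exists>v. guarded n t (bad n t) v \<and> visits n t (oracle_code X t) v}" for t
  have E [measurable]: "E t \<in> sets fair_coin_measure" for t
    unfolding E_def by (rule sets_oracle_event)
  have G [measurable]: "G t \<in> sets fair_coin_measure" for t
    unfolding G_def by (rule sets_oracle_event)
  have fires: "fires n t (bad n t) \<longleftrightarrow> q \<le> coin.prob (E t)" for t
    unfolding fires_iff E_def q_def n ..
  have in_C: "oracle_code X t mod 2 ^ level n \<in> set_decode (region n) \<longleftrightarrow> X \<in> C" if "l \<le> t" for X t
    using oracle_code_mod[OF that, of X] oracle_code_less[of X l] by (simp add: n C_def)
  show False
  proof (cases "\<exists>t1. \<forall>t\<ge>t1. \<not> fires n t (bad n t)")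
    case True
    then obtain t1 where t1: "\<And>t. t1 \<le> t \<Longrightarrow> \<not> fires n t (bad n t)" by auto
    \<comment> \<open>From stage \<open>s\<close> on, these oracles are always exposed or visiting a
      guard. Any single stage beyond \<open>t1\<close> bounds their measure, and the sets increase
      with \<open>s\<close>.\<close>
    define A where "A s = (\<Inter>t\<in>{s..}. E t \<union> G t)" for s
    have A: "A s \<in> sets fair_coin_measure" for s
      unfolding A_def using sets.top[of fair_coin_measure] by (intro sets.countable_INT'') auto
    have "coin.prob (A s) \<le> q + 2 / 2 ^ l" for s
    proof -
      have "coin.prob (A s) \<le> coin.prob (E (max s t1) \<union> G (max s t1))"
        unfolding A_def by (intro coin.finite_measure_mono) auto
      also have "\<dots> \<le> coin.prob (E (max s t1)) + coin.prob (G (max s t1))"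
        by (intro measure_Un_le) auto
      also have "coin.prob (E (max s t1)) \<le> q" using t1[of "max s t1"] by (simp add: fires)
      also have "coin.prob (G (max s t1)) \<le> 2 / 2 ^ l"
        using prob_guarded[of n] unfolding G_def n by blast
      finally show ?thesis by simp
    qed
    moreover have "(\<lambda>s. coin.prob (A s)) \<longlonglongrightarrow> coin.prob (\<Union>s. A s)"
      using A by (intro coin.finite_Lim_measure_incseq) (auto simp: A_def intro!: monoI)
    ultimately have le: "coin.prob (\<Union>s. A s) \<le> q + 2 / 2 ^ l"
      by (intro LIMSEQ_le_const2) auto
    have "readers e \<inter> C \<subseteq> (\<Union>s. A s)"
    proof
      fix X assume X: "X \<in> readers e \<inter> C"
      then have Xn: "X \<in> readers (pfst n)" by (simp add: n)
      obtain v where v: "pfst v = n" "v \<notin> bad_nodes"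
        "\<forall>v'. pfst v' = n \<longrightarrow> (X \<in> visited n v' \<longleftrightarrow> psnd v' \<noteq> 0 \<and> v' \<in> anc v)"
        using reader_path[OF Xn] by (elim exE conjE)
      have "psnd v = 0 \<or> X \<in> visited n v" using v(1,3) self_in_anc by blast
      then obtain t2 where t2: "psnd v = 0 \<or> visits n t2 (oracle_code X t2) v"
        by (auto simp: visited_iff)
      \<comment> \<open>The end \<open>v\<close> of the path never becomes bad, so once it has been
        reached \<open>X\<close> is exposed through it, except at stages where \<open>v\<close> is a
        guard.\<close>
      have "X \<in> E t \<union> G t" if t: "max (Suc v) (max t2 l) \<le> t" for t
      proof -
        have vis: "psnd v = 0 \<or> visits n t (oracle_code X t) v"
          using t2 visits_mono[of n t2 X v t] t by auto
        have nb: "v \<notin> set_decode (bad n t)" using v(1,2) by (auto simp: bad_nodes_def)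
        show ?thesis
        proof (cases "guarded n t (bad n t) v")
          case True
          then have "psnd v \<noteq> 0" by (simp add: guarded_def)
          with True vis have "X \<in> G t" unfolding G_def by blast
          then show ?thesis by simp
        next
          case False
          have "exposed n t (bad n t) (oracle_code X t)"
            unfolding exposed_def
            using in_C[of t X] X t v(1) nb False vis by (intro conjI exI[of _ v]) auto
          then show ?thesis by (simp add: E_def)
        qed
      qed
      then show "X \<in> (\<Union>s. A s)" unfolding A_def by blast
    qed
    then have "coin.prob (readers e \<inter> C) \<le> coin.prob (\<Union>s. A s)"
      using A by (intro coin.finite_measure_mono) auto
    \<comment> \<open>The bound \<open>q + 2 / 2 ^ l\<close> is at most \<open>5 * w / 8\<close>,
      less than the \<open>3 * w / 4\<close> inside \<open>C\<close>.\<close>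
    then show False using le inside q l by simp
  next
    case False
    \<comment> \<open>Oracles exposed at some firing stage after \<open>s\<close>. The measures are
      at least \<open>q\<close> and the sets decrease, so the oracles exposed at infinitely many
      firings still have measure at least \<open>q\<close>.\<close>
    define A where "A s = (\<Union>t\<in>{t. s \<le> t \<and> l \<le> t \<and> fires n t (bad n t)}. E t)" for s
    have A: "A s \<in> sets fair_coin_measure" for s unfolding A_def by auto
    have "q \<le> coin.prob (A s)" for s
    proof -
      have "\<exists>t\<ge>max s l. fires n t (bad n t)" using False by blast
      then obtain t where "max s l \<le> t" "fires n t (bad n t)" by blast
      then have t: "q \<le> coin.prob (E t)" "E t \<subseteq> A s" by (auto simp: fires A_def)
      from t(2) have "coin.prob (E t) \<le> coin.prob (A s)" using A by (rule coin.finite_measure_mono)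
      with t(1) show ?thesis by (rule order.trans)
    qed
    moreover have "(\<lambda>s. coin.prob (A s)) \<longlonglongrightarrow> coin.prob (\<Inter>s. A s)"
      using A by (intro coin.finite_Lim_measure_decseq)
        (auto simp: A_def decseq_def intro: order.trans)
    ultimately have ge: "q \<le> coin.prob (\<Inter>s. A s)"
      by (intro LIMSEQ_le_const) auto
    have "(\<Inter>s. A s) \<subseteq> C - readers e"
    proof
      fix X assume X: "X \<in> (\<Inter>s. A s)"
      then have "X \<in> A 0" by blast
      then have "X \<in> C" using in_C by (auto simp: A_def E_def exposed_def)
      moreover have "X \<notin> readers e"
      proof
        assume "X \<in> readers e"
        then have Xn: "X \<in> readers (pfst n)" by (simp add: n)
        obtain v where v:
          "\<forall>v'. pfst v' = n \<longrightarrow> (X \<in> visited n v' \<longleftrightarrow> psnd v' \<noteq> 0 \<and> v' \<in> anc v)"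
          using reader_path[OF Xn] by (elim exE conjE)
        \<comment> \<open>All nodes of this tree through which \<open>X\<close> can be exposed: the
          root and the visited nodes.\<close>
        define P where "P = insert (pair n 0) (anc v)"
        have "finite P" by (simp add: P_def finite_anc)
        \<comment> \<open>By finiteness of \<open>P\<close> there is a stage after which none of its
          nodes turns bad, yet each later firing with \<open>X\<close> exposed would turn one
          bad.\<close>
        then obtain s where s: "\<And>x. x \<in> P \<Longrightarrow> (\<exists>t. x \<in> B t) \<Longrightarrow> x \<in> B s"
        proof -
          have "\<exists>s. \<forall>x\<in>P. (\<exists>t. x \<in> B t) \<longrightarrow> x \<in> B s"
            using \<open>finite P\<close>
          proof induction
            case (insert x P)
            then obtain s where s: "\<forall>x\<in>P. (\<exists>t. x \<in> B t) \<longrightarrow> x \<in> B s" by auto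
            show ?case
            proof (cases "\<exists>t. x \<in> B t")
              case True
              then obtain t where "x \<in> B t" ..
              then have "\<forall>y\<in>insert x P. (\<exists>t. y \<in> B t) \<longrightarrow> y \<in> B (max s t)"
                using s bad_mono[of s "max s t" n] bad_mono[of t "max s t" n] unfolding B_def by auto
              then show ?thesis ..
            qed (use s in auto)
          qed simp
          then show ?thesis using that by blast
        qed
        have "X \<in> A s" using X by blast
        then obtain t where t: "s \<le> t" "fires n t (bad n t)" "X \<in> E t" by (auto simp: A_def)
        then obtain x where x: "x < t" "pfst x = n" "x \<notin> B t" "\<not> guarded n t (bad n t) x"
          "psnd x = 0 \<or> visits n t (oracle_code X t) x"
          unfolding E_def exposed_def B_def by blast
        have "x \<in> B (Suc t)" using x t by (simp add: B_def bad_Suc)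
        moreover have "x \<in> P"
        proof (cases "psnd x = 0")
          case True
          then have "x = pair n 0" using x(2) by (metis pair_pfst_psnd)
          then show ?thesis by (simp add: P_def)
        next
          case False
          then have "X \<in> visited n x" using x(5) by (auto simp: visited_iff)
          then show ?thesis using v x(2) by (simp add: P_def)
        qed
        ultimately have "x \<in> B s" using s by blast
        then show False using x(3) bad_mono[OF t(1), of n] by (auto simp: B_def)
      qed
      ultimately show "X \<in> C - readers e" by simp
    qed
    then have "coin.prob (\<Inter>s. A s) \<le> coin.prob (C - readers e)"
      by (intro coin.finite_measure_mono) auto
    then show False using ge outside q by simp
  qed
qed

section \<open>The tree structures\<close>

lemma pair_mono: "y \<le> y' \<Longrightarrow> pair x y \<le> pair x y'"
  by (simp add: prod_encode_triangle triangle_mono)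

lemma kid_greater: "v < kid v i"
proof -
  have "psnd v < Suc (pair (psnd v) i)" by (simp add: less_Suc_eq_le le_prod_encode_1)
  then have "pair (pfst v) (psnd v) \<le> kid v i"
    unfolding kid_def by (intro pair_mono) simp
  moreover have "v \<noteq> kid v i"
    using \<open>psnd v < _\<close> by (metis kid_def nat_neq_iff psnd_pair)
  ultimately show ?thesis by simp
qed

lemma anc_trans: assumes "u \<in> anc v" "v \<in> anc w" shows "u \<in> anc w"
proof -
  obtain a b where "u = (par ^^ a) v" "v = (par ^^ b) w" using assms by (auto simp: anc_def)
  then have "u = (par ^^ (a + b)) w" by (simp add: funpow_add)
  then show ?thesis by (simp add: anc_def)
qed

lemma anc_kid: "v \<in> anc (kid v i)"
  unfolding anc_def by (rule range_eqI[of _ _ 1]) simp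

lemma pfst_anc: "u \<in> anc v \<Longrightarrow> pfst u = pfst v"
proof -
  have "pfst ((par ^^ t) v) = pfst v" for t by (induction t) auto
  then show "u \<in> anc v \<Longrightarrow> pfst u = pfst v" by (auto simp: anc_def)
qed

text \<open>If one kid of \<open>v\<close> lay properly above another, it would be an ancestor of
  \<open>v\<close>; but ancestors have numbers at most \<open>v\<close>, and kids have larger
  ones.\<close>

lemma kid_in_anc_unique:
  assumes "kid v i \<in> anc w" "kid v j \<in> anc w" shows "i = j"
proof -
  have *: "i = j" if "a \<le> b" "kid v i = (par ^^ a) w" "kid v j = (par ^^ b) w" for a b i j
  proof (cases "b - a")
    case 0
    then have "kid v i = kid v j" using that by simp
    then show ?thesis by simp
  next
    case (Suc d)
    then have "b = Suc d + a" using that(1) by simp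
    then have "kid v j = (par ^^ Suc d) (kid v i)" using that by (simp add: funpow_add)
    then have "kid v j = (par ^^ d) v" by (simp add: funpow_swap1)
    then have "kid v j \<in> anc v" by (simp add: anc_def)
    then show ?thesis using anc_le kid_greater[of v j] by fastforce
  qed
  obtain a b where "kid v i = (par ^^ a) w" "kid v j = (par ^^ b) w"
    using assms by (auto simp: anc_def)
  then show ?thesis using *[of a b i j] *[of b a j i] by (cases "a \<le> b") auto
qed

text \<open>
  A class of the structure is indexed by a starting node and a copy number. Its label climbs
  to a kid picked by \<open>c\<close> as soon as the current node is found to be bad.
\<close>

definition climb :: "(nat \<Rightarrow> nat) \<Rightarrow> nat \<Rightarrow> nat \<Rightarrow> nat" where
  "climb c v s = rec_nat v (\<lambda>s v. if v \<in> set_decode (bad (pfst v) s) then kid v (c v) else v) s"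

text \<open>The element \<open>pair q (pair s t)\<close> of class \<open>q\<close> displays the
  \<open>t\<close>-th ancestor of the node that the class has reached at stage
  \<open>s\<close>.\<close>

definition label :: "(nat \<Rightarrow> nat) \<Rightarrow> nat \<Rightarrow> nat" where
  "label c x = (par ^^ psnd (psnd x)) (climb c (pfst (pfst x)) (pfst (psnd x)))"

text \<open>Relation 0 will be "in the same class", and relation \<open>Suc v\<close> will be the
  label \<open>v\<close>.\<close>

definition tree_language :: language where
  "tree_language = \<lparr>rels = (\<lambda>r. Some (if r = 0 then 2 else 1)), funs = (\<lambda>f. None)\<rparr>"

definition tree_struc :: "(nat \<Rightarrow> nat) \<Rightarrow> nat struc" where
  "tree_struc c = \<lparr>universe = UNIV,
     rel_int = (\<lambda>r xs. if r = 0 then pfst (xs ! 0) = pfst (xs ! 1) else label c (xs ! 0) = r - 1),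
     fun_int = (\<lambda>f xs. 0)\<rparr>"

definition escapes :: "(nat \<Rightarrow> nat) \<Rightarrow> bool" where
  "escapes c \<longleftrightarrow> (\<forall>v. \<exists>m. ((\<lambda>w. kid w (c w)) ^^ m) v \<notin> bad_nodes)"

definition final :: "(nat \<Rightarrow> nat) \<Rightarrow> nat \<Rightarrow> nat" where
  "final c v = climb c v (LEAST s. climb c v s \<notin> bad_nodes)"

lemma climb_0 [simp]: "climb c v 0 = v" by (simp add: climb_def)

lemma climb_Suc: "climb c v (Suc s) = (let w = climb c v s in
    if w \<in> set_decode (bad (pfst w) s) then kid w (c w) else w)"
  by (simp add: climb_def Let_def)

lemma climb_stable: "climb c v s \<notin> bad_nodes \<Longrightarrow> s \<le> s' \<Longrightarrow> climb c v s' = climb c v s"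
proof (induction s' rule: nat_induct)
  case (Suc s')
  then show ?case by (cases "s \<le> s'") (auto simp: climb_Suc Let_def bad_nodes_def le_Suc_eq)
qed auto

lemma climb_anc: "s \<le> s' \<Longrightarrow> climb c v s \<in> anc (climb c v s')"
proof (induction s' rule: dec_induct)
  case (step s')
  then show ?case
    using anc_trans[OF step.IH anc_kid] by (auto simp: climb_Suc Let_def)
qed (rule self_in_anc)

text \<open>A climb that meets only bad nodes cannot get stuck: the node it stands on is found bad
  at some stage and stays so, which forces the next move.\<close>

lemma climb_reaches:
  assumes "\<forall>s. climb c v s \<in> bad_nodes"
  shows "\<exists>s. climb c v s = ((\<lambda>w. kid w (c w)) ^^ m) v"
proof (induction m)
  case 0
  show ?case by (rule exI[of _ 0]) simp
next
  case (Suc m)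
  let ?z = "((\<lambda>w. kid w (c w)) ^^ m) v"
  obtain s where s: "climb c v s = ?z" using Suc by auto
  then have "?z \<in> bad_nodes" using assms by metis
  then obtain t where t: "?z \<in> set_decode (bad (pfst ?z) t)" by (auto simp: bad_nodes_def)
  have "climb c v s' = ?z \<or> (\<exists>s. climb c v s = kid ?z (c ?z))" if "s \<le> s'" for s'
    using that
  proof (induction s' rule: dec_induct)
    case base
    show ?case using s by simp
  next
    case (step s')
    then show ?case
      using climb_Suc[of c v s'] by (auto simp: Let_def split: if_splits)
  qed
  from this[of "max s t"] show ?case
  proof
    assume "climb c v (max s t) = ?z"
    moreover have "?z \<in> set_decode (bad (pfst ?z) (max s t))"
      using t bad_mono[of t "max s t"] by auto
    ultimately have "climb c v (Suc (max s t)) = kid ?z (c ?z)"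
      by (simp add: climb_Suc Let_def)
    then show ?case by auto
  qed auto
qed

lemma escapes_climb: "escapes c \<Longrightarrow> \<exists>s. climb c v s \<notin> bad_nodes"
proof (rule ccontr)
  assume c: "escapes c" and "\<nexists>s. climb c v s \<notin> bad_nodes"
  then have bad: "\<forall>s. climb c v s \<in> bad_nodes" by blast
  obtain m where "((\<lambda>w. kid w (c w)) ^^ m) v \<notin> bad_nodes" using c by (auto simp: escapes_def)
  then show False using climb_reaches[OF bad, of m] bad by metis
qed

lemma final:
  assumes "escapes c"
  shows final_good: "final c v \<notin> bad_nodes"
    and climb_eventually_final: "\<exists>s0. \<forall>s\<ge>s0. climb c v s = final c v"
    and climb_in_anc_final: "climb c v s \<in> anc (final c v)"
proof -
  show good: "final c v \<notin> bad_nodes"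
    unfolding final_def by (rule LeastI_ex[OF escapes_climb[OF assms]])
  then show ev: "\<exists>s0. \<forall>s\<ge>s0. climb c v s = final c v"
    unfolding final_def using climb_stable by blast
  then obtain s0 where "\<forall>s\<ge>s0. climb c v s = final c v" ..
  then have "climb c v (max s s0) = final c v" by simp
  then show "climb c v s \<in> anc (final c v)" using climb_anc[of s "max s s0" c v] by simp
qed

lemma final_eq_self: "v \<notin> bad_nodes \<Longrightarrow> final c v = v"
  unfolding final_def by (subst Least_equality[of _ 0]) auto

lemma label_in_anc: "escapes c \<Longrightarrow> label c x \<in> anc (final c (pfst (pfst x)))"
  unfolding label_def
  by (rule anc_trans[OF _ climb_in_anc_final]) (auto simp: anc_def)

text \<open>Once the climb has settled, each later stage contributes another element with the same
  label.\<close>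

lemma infinite_label:
  assumes "escapes c" "a \<in> anc (final c (pfst q))"
  shows "infinite {x. pfst x = q \<and> label c x = a}"
proof -
  obtain s0 where s0: "\<And>s. s0 \<le> s \<Longrightarrow> climb c (pfst q) s = final c (pfst q)"
    using climb_eventually_final[OF assms(1)] by blast
  obtain t where t: "a = (par ^^ t) (final c (pfst q))" using assms(2) by (auto simp: anc_def)
  have "(\<lambda>s. pair q (pair s t)) ` {s0..} \<subseteq> {x. pfst x = q \<and> label c x = a}"
    by (auto simp: label_def s0 t)
  moreover have "infinite ((\<lambda>s. pair q (pair s t)) ` {s0..})"
    using infinite_Ici by (subst finite_image_iff) (auto simp: inj_on_def)
  ultimately show ?thesis using finite_subset by blast
qed

section \<open>Isomorphism of the structures for different choices\<close>

text \<open>Over each index both fibres are countably infinite, so bijections of fibres can be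
  glued. It serves to match classes as well as elements.\<close>

lemma ex_bij_of_fibres:
  fixes f g :: "nat \<Rightarrow> 'k"
  assumes f: "\<And>k. k \<in> S \<Longrightarrow> infinite {x. f x = k}" "range f \<subseteq> S"
    and g: "\<And>k. k \<in> S \<Longrightarrow> infinite {x. g x = k}" "range g \<subseteq> S"
  shows "\<exists>h. bij h \<and> (\<forall>x. g (h x) = f x)"
proof -
  have "\<exists>b. bij_betw b {x. f x = k} {x. g x = k}" if "k \<in> S" for k
    using bij_betw_trans[OF to_nat_on_infinite[OF _ f(1)[OF that]]
        bij_betw_from_nat_into[OF _ g(1)[OF that]]] by auto
  then obtain b where b: "\<And>k. k \<in> S \<Longrightarrow> bij_betw (b k) {x. f x = k} {x. g x = k}" by metis
  have bf: "bij_betw (b (f x)) {y. f y = f x} {y. g y = f x}" for x using b f(2) by auto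
  let ?h = "\<lambda>x. b (f x) x"
  have gh: "g (?h x) = f x" for x
    using bij_betwE[OF bf[of x]] by auto
  have "inj ?h"
  proof (rule injI)
    fix x y assume eq: "?h x = ?h y"
    then have "f x = f y" using gh by metis
    then show "x = y" using eq bij_betw_imp_inj_on[OF bf[of x]] by (auto dest: inj_onD)
  qed
  moreover have "y \<in> range ?h" for y
  proof -
    have "bij_betw (b (g y)) {x. f x = g y} {x. g x = g y}" using b g(2) by auto
    then have "b (g y) ` {x. f x = g y} = {x. g x = g y}" by (rule bij_betw_imp_surj_on)
    moreover have "y \<in> {x. g x = g y}" by simp
    ultimately obtain x where "f x = g y" "y = b (g y) x" by blast
    then have "y = ?h x" by simp
    then show ?thesis by (rule range_eqI)
  qed
  ultimately show ?thesis using gh by (intro exI[of _ ?h]) (auto simp: bij_def)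
qed

text \<open>Classes are matched by their final nodes, and elements by class and label. Each good
  node is final for infinitely many classes, as those started at it never move.\<close>

lemma tree_struc_isomorphic:
  assumes c: "escapes c" and d: "escapes d"
  shows "isomorphic tree_language (tree_struc c) (tree_struc d)"
proof -
  have fib: "infinite {q. final c (pfst q) = w}" if "w \<notin> bad_nodes" for c w
  proof -
    have "range (pair w) \<subseteq> {q. final c (pfst q) = w}" using that by (auto simp: final_eq_self)
    moreover have "infinite (range (pair w))" by (intro range_inj_infinite) (auto simp: inj_def)
    ultimately show ?thesis using finite_subset by blast
  qed
  obtain k where k: "bij k" "\<And>q. final d (pfst (k q)) = final c (pfst q)"
    using ex_bij_of_fibres[of "- bad_nodes" "\<lambda>q. final c (pfst q)" "\<lambda>q. final d (pfst q)"]
      fib final_good[OF c] final_good[OF d] by blast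
  let ?S = "{(q, a). a \<in> anc (final d (pfst q))}"
  have "\<exists>h. bij h \<and> (\<forall>x. (pfst (h x), label d (h x)) = (k (pfst x), label c x))"
  proof (rule ex_bij_of_fibres)
    show "infinite {x. (k (pfst x), label c x) = z}" if "z \<in> ?S" for z
    proof -
      obtain q where q: "fst z = k q" using bij_is_surj[OF k(1)] by (metis surjD)
      then have "infinite {x. pfst x = q \<and> label c x = snd z}"
        using that k(2)[of q] by (intro infinite_label[OF c]) (auto simp: case_prod_beta)
      moreover have "{x. (k (pfst x), label c x) = z} = {x. pfst x = q \<and> label c x = snd z}"
        using q bij_is_inj[OF k(1)] by (auto simp: prod_eq_iff dest: injD)
      ultimately show ?thesis by simp
    qed
    show "infinite {x. (pfst x, label d x) = z}" if "z \<in> ?S" for z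
      using infinite_label[OF d, of "snd z" "fst z"] that by (auto simp: case_prod_beta prod_eq_iff)
    show "range (\<lambda>x. (k (pfst x), label c x)) \<subseteq> ?S"
      using label_in_anc[OF c] k(2) by auto
    show "range (\<lambda>x. (pfst x, label d x)) \<subseteq> ?S"
      using label_in_anc[OF d] by auto
  qed
  then obtain h where h: "bij h" "\<And>x. pfst (h x) = k (pfst x)" "\<And>x. label d (h x) = label c x"
    by auto
  have "struc_iso tree_language (tree_struc c) (tree_struc d) h"
    unfolding struc_iso_def tree_language_def tree_struc_def
    using h bij_is_inj[OF k(1)] by (auto split: if_splits simp: inj_eq)
  then show ?thesis unfolding isomorphic_def by blast
qed

text \<open>A choice made without regard to computability, used to fix the isomorphism type; it
  escapes in one move.\<close>

lemma escapes_good_choice: "escapes (\<lambda>v. SOME i. kid v i \<notin> bad_nodes)"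
proof -
  have "kid v (SOME i. kid v i \<notin> bad_nodes) \<notin> bad_nodes" for v
    by (rule someI_ex[OF ex_good_kid])
  then show ?thesis unfolding escapes_def by (intro allI exI[of _ 1]) simp
qed

section \<open>Generic choices\<close>

lemma Least_agree:
  fixes k :: nat
  assumes "\<And>j. j \<le> k \<Longrightarrow> P j = Q j" "Q k"
  shows "(LEAST j. P j) = (LEAST j. Q j)"
proof (rule Least_equality)
  have "(LEAST j. Q j) \<le> k" "Q (LEAST j. Q j)"
    using assms(2) by (auto intro: Least_le LeastI)
  then show "P (LEAST j. Q j)" using assms(1) by simp
  show "(LEAST j. Q j) \<le> j" if "P j" for j
    using assms(1)[of j] that \<open>(LEAST j. Q j) \<le> k\<close> Least_le[of Q j] by (cases "j \<le> k") auto
qed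

text \<open>Every number is \<open>pfst k\<close> for arbitrarily large \<open>k\<close>, so no finite part of \<open>X\<close> excludes a choice.\<close>

definition choice_of :: "(nat \<Rightarrow> bool) \<Rightarrow> nat \<Rightarrow> nat" where
  "choice_of X v = pfst (LEAST k. X (pair v k))"

definition generic :: "(nat \<Rightarrow> bool) set" where
  "generic = {X. (\<forall>v. \<exists>k. X (pair v k)) \<and> escapes (choice_of X)}"

lemma nowhere_denseI:
  fixes S :: "(nat \<Rightarrow> bool) set"
  assumes "\<And>X m. \<exists>Y m'. (\<forall>i<m. Y i = X i) \<and> (\<forall>Z. (\<forall>i<m'. Z i = Y i) \<longrightarrow> Z \<notin> S)"
  shows "nowhere_dense S"
proof -
  have False if "X \<in> interior (closure S)" for X
  proof -
    have "openin (product_topology (\<lambda>i. euclidean) UNIV) (interior (closure S))"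
      using open_interior[of "closure S"] unfolding open_fun_def .
    from product_topology_open_contains_basis[OF this \<open>X \<in> _\<close>]
    obtain B where B: "X \<in> Pi\<^sub>E UNIV B" "finite {i. B i \<noteq> (UNIV :: bool set)}"
      "Pi\<^sub>E UNIV B \<subseteq> interior (closure S)" by auto
    obtain m where m: "\<And>i. B i \<noteq> UNIV \<Longrightarrow> i < m"
      using B(2) finite_nat_set_iff_bounded[of "{i. B i \<noteq> UNIV}"] by auto
    obtain Y m' where Y: "\<And>i. i < m \<Longrightarrow> Y i = X i" "\<And>Z. (\<forall>i<m'. Z i = Y i) \<Longrightarrow> Z \<notin> S"
      using assms by metis
    have "Y i \<in> B i" for i
      using m[of i] Y(1)[of i] B(1) by (cases "B i = UNIV") (auto simp: PiE_iff)
    then have "Y \<in> Pi\<^sub>E UNIV B" by (simp add: PiE_iff)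
    then have "Y \<in> closure S" using B(3) interior_subset[of "closure S"] by auto
    moreover have "open (\<Inter>i\<in>{..<m'}. (\<lambda>Z. Z i) -` {Y i})"
      by (intro open_INT ballI open_vimage continuous_on_product_coordinates) (auto intro: Topological_Spaces.open_discrete)
    moreover have "Y \<in> (\<Inter>i\<in>{..<m'}. (\<lambda>Z. Z i) -` {Y i})" by simp
    ultimately have "(\<Inter>i\<in>{..<m'}. (\<lambda>Z. Z i) -` {Y i}) \<inter> S \<noteq> {}"
      by (meson open_Int_closure_eq_empty disjoint_iff)
    then show False using Y(2) by auto
  qed
  then show ?thesis unfolding nowhere_dense_def by auto
qed

text \<open>Given finitely many bits, follow the choices they determine, starting at
  \<open>v\<close>. The numbers of the nodes grow, so an undetermined choice comes up, and it can be
  set to a good kid.\<close>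

lemma meagre_not_generic: "meagre (- generic)"
proof -
  let ?z = "\<lambda>X v m. ((\<lambda>w. kid w (choice_of X w)) ^^ m) v"
  define N where "N v = {X. (\<nexists>k. X (pair v k)) \<or> (\<forall>m. ?z X v m \<in> bad_nodes)}" for v
  have "nowhere_dense (N v)" for v
  proof (rule nowhere_denseI)
    fix X :: "nat \<Rightarrow> bool" and m0 :: nat
    \<comment> \<open>A 1 in row \<open>w\<close> among the given bits settles the least 1 of that
      row, since \<open>pair w\<close> is increasing.\<close>
    define decided where "decided w \<longleftrightarrow> (\<exists>k. pair w k < m0 \<and> X (pair w k))" for w
    have decided_choice: "choice_of Z w = choice_of X w"
      if Z: "\<forall>i<m0. Z i = X i" and w: "decided w" for Z w
    proof -
      obtain k where k: "pair w k < m0" "X (pair w k)" using w decided_def by auto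
      have agree: "Z (pair w j) = X (pair w j)" if "j \<le> k" for j
        using Z k(1) pair_mono[OF that, of w] by simp
      have "(LEAST k. Z (pair w k)) = (LEAST k. X (pair w k))"
        by (rule Least_agree[of k]) (use agree k(2) in auto)
      then show ?thesis by (simp add: choice_of_def)
    qed
    have ge: "m \<le> ?z X v m" for m
    proof (induction m)
      case (Suc m)
      then show ?case using kid_greater[of "?z X v m" "choice_of X (?z X v m)"] by simp
    qed simp
    have "\<not> decided (?z X v m0)"
      using ge[of m0] le_prod_encode_1 by (auto simp: decided_def) (meson leD le_trans)
    then obtain m where m: "\<not> decided (?z X v m)" "\<And>j. j < m \<Longrightarrow> decided (?z X v j)"
      using exists_least_iff[of "\<lambda>m. \<not> decided (?z X v m)"] by auto
    define w where "w = ?z X v m"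
    obtain i where i: "kid w i \<notin> bad_nodes" using ex_good_kid by blast
    \<comment> \<open>The component \<open>i\<close> selects the good kid, and \<open>m0\<close>
      moves the bit \<open>pair w k\<close> beyond those already given. In \<open>Y\<close> it is
      the only 1 among the new bits.\<close>
    define k where "k = pair i m0"
    define Y where "Y j = (if j < m0 then X j else j = pair w k)" for j
    have "Z \<notin> N v" if Z: "\<forall>j<Suc (pair w k). Z j = Y j" for Z
    proof -
      have m0: "m0 \<le> pair w k"
        unfolding k_def using le_prod_encode_2 by (meson le_trans)
      then have ZX: "\<forall>j<m0. Z j = X j" using Z by (simp add: Y_def)
      have zz: "?z Z v j = ?z X v j" if "j \<le> m" for j
        using that by (induction j) (auto simp: decided_choice[OF ZX m(2)])
      have "Z (pair w k)" using Z m0 by (simp add: Y_def)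
      moreover have "\<not> Z (pair w j)" if "j < k" for j
      proof -
        have "pair w j \<le> pair w k" "pair w j \<noteq> pair w k" using that pair_mono by auto
        then show ?thesis using Z m(1) by (auto simp: Y_def decided_def w_def)
      qed
      ultimately have "(LEAST j. Z (pair w j)) = k"
        by (intro Least_equality) (auto simp: not_less[symmetric])
      then have "choice_of Z w = i" by (simp add: choice_of_def k_def)
      then have "?z Z v (Suc m) \<notin> bad_nodes" using zz[of m] i by (simp add: w_def)
      moreover have "\<exists>k. Z (pair v k)"
      proof (cases m)
        case 0
        then show ?thesis using \<open>Z (pair w k)\<close> by (auto simp: w_def)
      next
        case (Suc _)
        then show ?thesis using m(2)[of 0] ZX by (auto simp: decided_def)
      qed
      ultimately show "Z \<notin> N v" unfolding N_def by blast
    qed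
    then show "\<exists>Y m'. (\<forall>i<m0. Y i = X i) \<and> (\<forall>Z. (\<forall>i<m'. Z i = Y i) \<longrightarrow> Z \<notin> N v)"
      by (intro exI[of _ Y] exI[of _ "Suc (pair w k)"]) (auto simp: Y_def)
  qed
  moreover have "- generic \<subseteq> (\<Union>v. N v)"
    unfolding generic_def escapes_def N_def by blast
  ultimately show ?thesis unfolding meagre_def by blast
qed

section \<open>Atomic diagrams of copies\<close>

lemma rc_climb [rec_intros]:
  assumes "recursive_in A c" "recursive_in A f" "recursive_in A g"
  shows "recursive_in A (\<lambda>x. climb c (f x) (g x))"
  unfolding climb_def by (intro rec_intros rc_comp[OF assms(1)] assms)

lemma rc_label [rec_intros]:
  assumes "recursive_in A c" "recursive_in A f"
  shows "recursive_in A (\<lambda>x. label c (f x))"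
  unfolding label_def by (intro rec_intros assms rc_par rc_id)

lemma rc_choice_of:
  assumes "\<forall>v. \<exists>k. X (pair v k)"
  shows "recursive_in {i. X i} (choice_of X)"
proof -
  have "decidable {i. X i} (\<lambda>z. X (pair (pfst z) (psnd z)))"
    using rc_comp[OF recursive_in_oracle, of "{i. X i}" "\<lambda>z. pair (pfst z) (psnd z)"]
      rc_pair[OF rc_pfst[OF rc_id] rc_psnd[OF rc_id]] by simp
  then have "recursive_in {i. X i} (\<lambda>v. LEAST k. X (pair v k))"
    using assms by (intro rc_least) auto
  then show ?thesis unfolding choice_of_def by (intro rec_intros)
qed

section \<open>Codes of atoms and their truth\<close>

definition eq_code :: "nat \<Rightarrow> nat \<Rightarrow> nat" where
  "eq_code a b = sum_encode (Inl (pair (sum_encode (Inl a)) (sum_encode (Inl b))))"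

definition class_code :: "nat \<Rightarrow> nat \<Rightarrow> nat" where
  "class_code a b = sum_encode (Inr (pair 0 (list_encode [sum_encode (Inl a), sum_encode (Inl b)])))"

definition label_code :: "nat \<Rightarrow> nat \<Rightarrow> nat" where
  "label_code v a = sum_encode (Inr (pair (Suc v) (list_encode [sum_encode (Inl a)])))"

definition atom_true :: "nat struc \<Rightarrow> nat \<Rightarrow> bool" where
  "atom_true N x \<longleftrightarrow>
     (\<exists>a\<in>universe N. x = eq_code a a) \<or>
     (\<exists>a\<in>universe N. \<exists>b\<in>universe N. x = class_code a b \<and> rel_int N 0 [a, b]) \<or>
     (\<exists>a\<in>universe N. \<exists>v. x = label_code v a \<and> rel_int N (Suc v) [a])"

definition atom_false :: "nat struc \<Rightarrow> nat \<Rightarrow> bool" where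
  "atom_false N x \<longleftrightarrow>
     (\<exists>a\<in>universe N. \<exists>b\<in>universe N. x = eq_code a b \<and> a \<noteq> b) \<or>
     (\<exists>a\<in>universe N. \<exists>b\<in>universe N. x = class_code a b \<and> \<not> rel_int N 0 [a, b]) \<or>
     (\<exists>a\<in>universe N. \<exists>v. x = label_code v a \<and> \<not> rel_int N (Suc v) [a])"

lemma wf_cterm_tree_language: "wf_cterm tree_language U t \<longleftrightarrow> (\<exists>a\<in>U. t = Elem a)"
  by (cases t) (auto simp: tree_language_def)

lemma wf_atom_tree_language_Rel:
  "wf_atom tree_language U (Rel r ts) \<longleftrightarrow>
     length ts = (if r = 0 then 2 else 1) \<and> (\<forall>t\<in>set ts. \<exists>a\<in>U. t = Elem a)"
  unfolding wf_atom.simps wf_cterm_tree_language by (auto simp: tree_language_def)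

text \<open>There are no function symbols, so closed terms are elements and atoms have just these
  three shapes; the inductive form provides the case analysis.\<close>

inductive tree_atom :: "nat set \<Rightarrow> nat atom \<Rightarrow> bool" for U where
  "a \<in> U \<Longrightarrow> b \<in> U \<Longrightarrow> tree_atom U (Equal (Elem a) (Elem b))"
| "a \<in> U \<Longrightarrow> b \<in> U \<Longrightarrow> tree_atom U (Rel 0 [Elem a, Elem b])"
| "a \<in> U \<Longrightarrow> tree_atom U (Rel (Suc v) [Elem a])"

lemma wf_atom_iff_tree_atom: "wf_atom tree_language U \<phi> \<longleftrightarrow> tree_atom U \<phi>"
proof
  assume wf: "wf_atom tree_language U \<phi>"
  show "tree_atom U \<phi>"
  proof (cases \<phi>)
    case (Equal s t)
    then obtain a b where "a \<in> U" "s = Elem a" "b \<in> U" "t = Elem b"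
      using wf unfolding Equal wf_atom.simps wf_cterm_tree_language by (elim conjE bexE)
    then show ?thesis by (simp add: Equal tree_atom.intros)
  next
    case (Rel r ts)
    note ts = wf[unfolded Rel wf_atom_tree_language_Rel]
    show ?thesis
    proof (cases r)
      case 0
      then obtain s t where st: "ts = [s, t]" using ts by (auto simp: numeral_2_eq_2 length_Suc_conv)
      then obtain a b where "a \<in> U" "s = Elem a" "b \<in> U" "t = Elem b" using ts by auto
      then show ?thesis by (simp add: Rel 0 st tree_atom.intros)
    next
      case (Suc v)
      then obtain s where st: "ts = [s]" using ts by (auto simp: length_Suc_conv)
      then obtain a where "a \<in> U" "s = Elem a" using ts by auto
      then show ?thesis by (simp add: Rel Suc st tree_atom.intros)
    qed
  qed
qed (auto elim!: tree_atom.cases simp: wf_cterm_tree_language wf_atom_tree_language_Rel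
      simp del: wf_atom.simps(2))

lemma mem_atomic_diagram:
  "x \<in> atomic_diagram tree_language N \<longleftrightarrow>
     (\<exists>y. x = sum_encode (Inl y) \<and> atom_true N y) \<or> (\<exists>y. x = sum_encode (Inr y) \<and> atom_false N y)"
proof -
  have ex: "(\<exists>\<phi>. wf_atom tree_language U \<phi> \<and> Q \<phi>) \<longleftrightarrow>
      (\<exists>a\<in>U. \<exists>b\<in>U. Q (Equal (Elem a) (Elem b))) \<or> (\<exists>a\<in>U. \<exists>b\<in>U. Q (Rel 0 [Elem a, Elem b])) \<or>
      (\<exists>a\<in>U. \<exists>v. Q (Rel (Suc v) [Elem a]))" for Q and U :: "nat set"
    unfolding wf_atom_iff_tree_atom
  proof
    assume "\<exists>\<phi>. tree_atom U \<phi> \<and> Q \<phi>"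
    then obtain \<phi> where "tree_atom U \<phi>" "Q \<phi>" by (elim exE conjE)
    then show "(\<exists>a\<in>U. \<exists>b\<in>U. Q (Equal (Elem a) (Elem b))) \<or>
        (\<exists>a\<in>U. \<exists>b\<in>U. Q (Rel 0 [Elem a, Elem b])) \<or> (\<exists>a\<in>U. \<exists>v. Q (Rel (Suc v) [Elem a]))"
      by cases auto
  qed (auto intro: tree_atom.intros)
  have pos: "(\<exists>\<phi>. wf_atom tree_language (universe N) \<phi> \<and> (y = atom_code \<phi> \<and> holds_atom N \<phi>))
      \<longleftrightarrow> atom_true N y" for y
    unfolding ex atom_true_def eq_code_def class_code_def label_code_def
    by (simp only: atom_code.simps cterm_code.simps holds_atom.simps cterm_val.simps list.map) blast
  have neg: "(\<exists>\<phi>. wf_atom tree_language (universe N) \<phi> \<and> (y = atom_code \<phi> \<and> \<not> holds_atom N \<phi>))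
      \<longleftrightarrow> atom_false N y" for y
    unfolding ex atom_false_def eq_code_def class_code_def label_code_def
    by (simp only: atom_code.simps cterm_code.simps holds_atom.simps cterm_val.simps list.map)
  show ?thesis
    unfolding atomic_diagram_def diagram_def image_Un Un_iff pos[symmetric] neg[symmetric]
    by (rule arg_cong2[of _ _ _ _ "(\<or>)"]) (auto simp: image_iff)
qed

lemma sum_encode_Inl: "sum_encode (Inl x) = 2 * x" and sum_encode_Inr: "sum_encode (Inr x) = Suc (2 * x)"
  by (simp_all add: sum_encode_def)

lemma rc_sum_encode [rec_intros]:
  assumes "recursive_in A f"
  shows "recursive_in A (\<lambda>x. sum_encode (Inl (f x)))" "recursive_in A (\<lambda>x. sum_encode (Inr (f x)))"
  unfolding sum_encode_Inl sum_encode_Inr by (intro rec_intros assms)+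

lemma rc_codes [rec_intros]:
  assumes "recursive_in A f" "recursive_in A g"
  shows "recursive_in A (\<lambda>x. eq_code (f x) (g x))"
    and "recursive_in A (\<lambda>x. class_code (f x) (g x))"
    and "recursive_in A (\<lambda>x. label_code (f x) (g x))"
  unfolding eq_code_def class_code_def label_code_def list_encode.simps
  by (intro rec_intros assms)+

lemma codes_bounds:
  "a \<le> eq_code a b" "b \<le> eq_code a b" "a \<le> class_code a b" "b \<le> class_code a b"
  "v \<le> label_code v a" "a \<le> label_code v a"
proof -
  have p: "x \<le> z \<Longrightarrow> x \<le> pair z y" "y' \<le> y \<Longrightarrow> y' \<le> pair x y" for x y z y'
    using le_prod_encode_1 le_prod_encode_2 order.trans by blast+
  have s: "x \<le> y \<Longrightarrow> x \<le> sum_encode (Inl y)" "x \<le> y \<Longrightarrow> x \<le> sum_encode (Inr y)" "x \<le> y \<Longrightarrow> x \<le> Suc y"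
    for x y by (simp_all add: sum_encode_def)
  show "a \<le> eq_code a b" "b \<le> eq_code a b"
    unfolding eq_code_def by (intro s p order.refl)+
  show "a \<le> class_code a b" "a \<le> label_code v a" "v \<le> label_code v a"
    unfolding class_code_def label_code_def list_encode.simps
    by (rule s, rule p(2), rule s, rule p(1), rule s, rule order.refl)+
      (rule s, rule p(1), rule s, rule order.refl)
  show "b \<le> class_code a b"
    unfolding class_code_def list_encode.simps
    by (rule s, rule p(2), rule s, rule p(2), rule s, rule p(1), rule s, rule order.refl)
qed

lemma bounded_ex: "(\<And>a. P a \<Longrightarrow> a \<le> x) \<Longrightarrow> (\<exists>a. P a) \<longleftrightarrow> (\<exists>a<Suc x. P a)" for x :: nat
  by (auto simp: less_Suc_eq_le)

lemma bounded_ex2: "(\<And>a b. P a b \<Longrightarrow> a \<le> x \<and> b \<le> x) \<Longrightarrow> (\<exists>a b. P a b) \<longleftrightarrow> (\<exists>a<Suc x. \<exists>b<Suc x. P a b)"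
  for x :: nat
  unfolding less_Suc_eq_le by metis

text \<open>The code of an atom bounds the elements and the label in it, so a bounded search
  recovers them. Classes and labels are computable from the choice function, which \<open>X\<close>
  computes.\<close>

lemma diagram_tree_struc_le:
  assumes "X \<in> generic"
  shows "turing_le (atomic_diagram tree_language (tree_struc (choice_of X))) {i. X i}"
proof -
  let ?c = "choice_of X"
  have c: "recursive_in {i. X i} ?c"
    using assms by (intro rc_choice_of) (simp add: generic_def)
  have true: "atom_true (tree_struc ?c) y \<longleftrightarrow>
      (\<exists>a<Suc y. y = eq_code a a) \<or>
      (\<exists>a<Suc y. \<exists>b<Suc y. y = class_code a b \<and> pfst a = pfst b) \<or>
      (\<exists>a<Suc y. \<exists>v<Suc y. y = label_code v a \<and> label ?c a = v)" for y
  proof -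
    have "atom_true (tree_struc ?c) y \<longleftrightarrow> (\<exists>a. y = eq_code a a) \<or>
        (\<exists>a b. y = class_code a b \<and> pfst a = pfst b) \<or> (\<exists>a v. y = label_code v a \<and> label ?c a = v)"
      unfolding atom_true_def tree_struc_def by simp
    then show ?thesis
      by (simp only:) (intro arg_cong2[of _ _ _ _ "(\<or>)"] bounded_ex bounded_ex2; auto simp: codes_bounds)
  qed
  have false: "atom_false (tree_struc ?c) y \<longleftrightarrow>
      (\<exists>a<Suc y. \<exists>b<Suc y. y = eq_code a b \<and> a \<noteq> b) \<or>
      (\<exists>a<Suc y. \<exists>b<Suc y. y = class_code a b \<and> pfst a \<noteq> pfst b) \<or>
      (\<exists>a<Suc y. \<exists>v<Suc y. y = label_code v a \<and> label ?c a \<noteq> v)" for y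
  proof -
    have "atom_false (tree_struc ?c) y \<longleftrightarrow> (\<exists>a b. y = eq_code a b \<and> a \<noteq> b) \<or>
        (\<exists>a b. y = class_code a b \<and> pfst a \<noteq> pfst b) \<or> (\<exists>a v. y = label_code v a \<and> label ?c a \<noteq> v)"
      unfolding atom_false_def tree_struc_def by simp
    then show ?thesis
      by (simp only:) (intro arg_cong2[of _ _ _ _ "(\<or>)"] bounded_ex bounded_ex2; auto simp: codes_bounds)
  qed
  have "x \<in> atomic_diagram tree_language (tree_struc ?c) \<longleftrightarrow>
      (\<exists>y<Suc x. x = sum_encode (Inl y) \<and> atom_true (tree_struc ?c) y) \<or>
      (\<exists>y<Suc x. x = sum_encode (Inr y) \<and> atom_false (tree_struc ?c) y)" for x
    unfolding mem_atomic_diagram by (auto simp: sum_encode_def less_Suc_eq_le)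
  then show ?thesis
    unfolding turing_le_def true false by (simp only:) (intro rec_intros c)
qed

section \<open>From a copy to a reading program\<close>

text \<open>The search may diverge, hence the exact graph of the program in place of a statement
  about a total function. The witness \<open>s\<close> pairs the value with auxiliary data.\<close>

lemma partial_search:
  assumes "decidable A (\<lambda>z. R (pfst z) (psnd z))"
  shows "\<exists>p. \<forall>x y. eval A p [x] y \<longleftrightarrow> (\<exists>s. R x s \<and> (\<forall>s'<s. \<not> R x s') \<and> y = pfst s)"
proof -
  have "rcl A 2 (\<lambda>xs. of_bool (\<not> R (xs ! 1) (xs ! 0)))"
    using rcl_comp1[OF rc_not[OF assms, unfolded recursive_in_iff_rcl]
        rcl_pair[OF rcl_proj[of 1] rcl_proj[of 0]], of 2] by simp
  then obtain p where p: "\<forall>xs. length xs = 2 \<longrightarrow> eval A p xs (of_bool (\<not> R (xs ! 1) (xs ! 0)))"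
    unfolding rcl_def ..
  have p: "eval A p [s, x] (of_bool (\<not> R x s))" for s x using p[rule_format, of "[s, x]"] by simp
  then have p_iff: "eval A p [s, x] v \<longleftrightarrow> v = of_bool (\<not> R x s)" for s x v
    using eval_deterministic by blast
  obtain q where "\<forall>x. eval A q [x] (pfst x)"
    using rc_pfst[OF rc_id] unfolding recursive_in_def ..
  then have q_iff: "eval A q [x] v \<longleftrightarrow> v = pfst x" for x v
    using eval_deterministic by blast
  have mu_iff: "eval A (Mu p) [x] s \<longleftrightarrow> R x s \<and> (\<forall>s'<s. \<not> R x s')" for x s
  proof
    show "eval A (Mu p) [x] s \<Longrightarrow> R x s \<and> (\<forall>s'<s. \<not> R x s')"
      by (erule eval_MuE) (auto simp: p_iff split: if_splits)
    show "R x s \<and> (\<forall>s'<s. \<not> R x s') \<Longrightarrow> eval A (Mu p) [x] s"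
      by (rule eval.Mu) (auto simp: p_iff)
  qed
  have "eval A (Comp q [Mu p]) [x] y \<longleftrightarrow> (\<exists>s. R x s \<and> (\<forall>s'<s. \<not> R x s') \<and> y = pfst s)" for x y
  proof
    assume "eval A (Comp q [Mu p]) [x] y"
    then obtain ys where ys: "length ys = length [Mu p]"
      "\<forall>i<length [Mu p]. eval A ([Mu p] ! i) [x] (ys ! i)" "eval A q ys y"
      by (rule eval_CompE)
    then obtain s where "ys = [s]" by (auto simp: length_Suc_conv)
    then show "\<exists>s. R x s \<and> (\<forall>s'<s. \<not> R x s') \<and> y = pfst s"
      using ys(2,3) by (auto simp: mu_iff q_iff)
  next
    assume "\<exists>s. R x s \<and> (\<forall>s'<s. \<not> R x s') \<and> y = pfst s"
    then obtain s where "R x s" "\<forall>s'<s. \<not> R x s'" "y = pfst s" by (elim exE conjE)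
    then show "eval A (Comp q [Mu p]) [x] y"
      by (intro eval.Comp[of "[s]"]) (auto simp: mu_iff q_iff)
  qed
  then show ?thesis by blast
qed

lemma class_code_iff: "sum_encode (Inl (class_code a b)) \<in> atomic_diagram tree_language N \<longleftrightarrow>
    a \<in> universe N \<and> b \<in> universe N \<and> rel_int N 0 [a, b]"
  unfolding mem_atomic_diagram atom_true_def class_code_def eq_code_def label_code_def
  by (auto simp: sum_encode_eq prod_encode_eq)

lemma label_code_iff: "sum_encode (Inl (label_code v a)) \<in> atomic_diagram tree_language N \<longleftrightarrow>
    a \<in> universe N \<and> rel_int N (Suc v) [a]"
  unfolding mem_atomic_diagram atom_true_def class_code_def eq_code_def label_code_def
  by (auto simp: sum_encode_eq prod_encode_eq)

text \<open>In each tree the program settles on the class of the least element labelled by the root,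
  and answers \<open>D\<close> by finding in that class an element labelled by a kid of
  \<open>D\<close>. The labels of a class are exactly the ancestors of its final node.\<close>

lemma reader_of_copy:
  assumes c: "escapes c" and iso: "isomorphic tree_language (tree_struc c) N"
    and le: "turing_le (atomic_diagram tree_language N) {i. X i}"
  shows "\<exists>e. X \<in> readers e"
proof -
  define AD where "AD = atomic_diagram tree_language N"
  have dec_AD: "decidable {i. X i} (\<lambda>x. x \<in> AD)" using le by (simp add: turing_le_def AD_def)
  obtain h where h: "struc_iso tree_language (tree_struc c) N h" using iso by (auto simp: isomorphic_def)
  then have bij: "bij_betw h UNIV (universe N)" by (simp add: struc_iso_def tree_struc_def)
  then have range: "range h = universe N" by (rule bij_betw_imp_surj_on)
  have rel: "rel_int (tree_struc c) r xs \<longleftrightarrow> rel_int N r (map h xs)"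
    if "length xs = (if r = 0 then 2 else 1)" for r xs
  proof -
    have "\<forall>r k xs. rels tree_language r = Some k \<longrightarrow> length xs = k \<longrightarrow>
        set xs \<subseteq> universe (tree_struc c) \<longrightarrow> rel_int (tree_struc c) r xs = rel_int N r (map h xs)"
      using h unfolding struc_iso_def by (elim conjE)
    from this[rule_format, of r "length xs" xs] that show ?thesis
      by (simp add: tree_language_def tree_struc_def)
  qed
  have rel0: "rel_int N 0 [h x, h y] \<longleftrightarrow> pfst x = pfst y" for x y
    using rel[of "[x, y]" 0] by (simp add: tree_struc_def)
  have rel1: "rel_int N (Suc v) [h x] \<longleftrightarrow> label c x = v" for x v
    using rel[of "[x]" "Suc v"] by (simp add: tree_struc_def)
  let ?P = "\<lambda>v y. sum_encode (Inl (label_code v y)) \<in> AD"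
  let ?Q = "\<lambda>x y. sum_encode (Inl (class_code x y)) \<in> AD"
  have P: "?P v y \<longleftrightarrow> (\<exists>z. y = h z \<and> label c z = v)" for v y
    unfolding AD_def label_code_iff range[symmetric] using rel1 by auto
  have Q: "?Q (h x) y \<longleftrightarrow> (\<exists>z. y = h z \<and> pfst x = pfst z)" for x y
    unfolding AD_def class_code_iff range[symmetric] using rel0 by auto
  \<comment> \<open>A class started at the root of tree \<open>n\<close> keeps this root among its
    labels wherever it climbs.\<close>
  have root: "\<exists>y. ?P (pair n 0) y" for n
  proof -
    have "pair n 0 \<in> anc (final c (pair n 0))"
      using climb_in_anc_final[OF c, of "pair n 0" 0] by simp
    then have "infinite {x. pfst x = pair (pair n 0) 0 \<and> label c x = pair n 0}"
      by (intro infinite_label[OF c]) simp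
    from not_finite_existsD[OF this] obtain x where "label c x = pair n 0" by (elim exE conjE)
    then have "?P (pair n 0) (h x)" unfolding P by (intro exI[of _ x] conjI refl)
    then show ?thesis by (rule exI)
  qed
  define r where "r n = (LEAST y. ?P (pair n 0) y)" for n
  have rcP: "decidable {i. X i} (\<lambda>x. ?P (f x) (g x))"
    if "recursive_in {i. X i} f" "recursive_in {i. X i} g" for f g
    by (intro rc_comp[OF dec_AD] rec_intros that)
  have rcQ: "decidable {i. X i} (\<lambda>x. ?Q (f x) (g x))"
    if "recursive_in {i. X i} f" "recursive_in {i. X i} g" for f g
    by (intro rc_comp[OF dec_AD] rec_intros that)
  have rr: "recursive_in {i. X i} r"
    unfolding r_def by (intro rc_least rcP root rec_intros)
  have "decidable {i. X i} (\<lambda>z. ?Q (r (pfst (pfst z))) (psnd (psnd z)) \<and>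
      ?P (kid (pfst z) (pfst (psnd z))) (psnd (psnd z)))"
    by (intro rcP rcQ rec_intros rc_comp[OF rr])
  from partial_search[OF this] obtain p where p: "\<forall>D i. eval {i. X i} p [D] i \<longleftrightarrow>
      (\<exists>s. (?Q (r (pfst D)) (psnd s) \<and> ?P (kid D (pfst s)) (psnd s)) \<and>
        (\<forall>s'<s. \<not> (?Q (r (pfst D)) (psnd s') \<and> ?P (kid D (pfst s')) (psnd s'))) \<and> i = pfst s)" ..
  obtain e where e: "dec e = p" using dec_surj by blast
  have "\<exists>w. pfst w = n \<and> w \<notin> bad_nodes \<and>
     (\<forall>D i. pfst D = n \<longrightarrow> (eval {i. X i} (dec e) [D] i \<longleftrightarrow> kid D i \<in> anc w))" for n
  proof -
    have "?P (pair n 0) (r n)" unfolding r_def by (rule LeastI_ex[OF root])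
    then obtain x where x: "r n = h x" "label c x = pair n 0" unfolding P by (elim exE conjE)
    define w where "w = final c (pfst (pfst x))"
    have "pair n 0 \<in> anc w" using label_in_anc[OF c, of x] x by (simp add: w_def)
    then have pw: "pfst w = n" using pfst_anc[of "pair n 0" w] by simp
    have injh: "h z = h z' \<longleftrightarrow> z = z'" for z z'
      using bij_betw_imp_inj_on[OF bij] by (rule inj_eq)
    have QP: "?Q (r n) y \<and> ?P v y \<longleftrightarrow> (\<exists>z. y = h z \<and> pfst z = pfst x \<and> label c z = v)" for v y
      unfolding x(1) Q P
    proof
      assume "(\<exists>z. y = h z \<and> pfst x = pfst z) \<and> (\<exists>z. y = h z \<and> label c z = v)"
      then obtain z z' where "y = h z" "pfst x = pfst z" "y = h z'" "label c z' = v" by (elim exE conjE)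
      then show "\<exists>z. y = h z \<and> pfst z = pfst x \<and> label c z = v"
        using injh[of z z'] by (intro exI[of _ z]) simp
    next
      assume "\<exists>z. y = h z \<and> pfst z = pfst x \<and> label c z = v"
      then obtain z where "y = h z" "pfst z = pfst x" "label c z = v" by (elim exE conjE)
      then show "(\<exists>z. y = h z \<and> pfst x = pfst z) \<and> (\<exists>z. y = h z \<and> label c z = v)"
        by (intro conjI exI[of _ z]) simp_all
    qed
    have in_anc: "v \<in> anc w \<longleftrightarrow> (\<exists>y. ?Q (r n) y \<and> ?P v y)" for v
    proof
      assume "v \<in> anc w"
      then have "infinite {z. pfst z = pfst x \<and> label c z = v}"
        by (intro infinite_label[OF c]) (simp add: w_def)
      from not_finite_existsD[OF this] obtain z where "pfst z = pfst x" "label c z = v" by (elim exE conjE)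
      then show "\<exists>y. ?Q (r n) y \<and> ?P v y" unfolding QP by (intro exI[of _ "h z"] exI[of _ z] conjI refl)
    next
      assume "\<exists>y. ?Q (r n) y \<and> ?P v y"
      then obtain z where "pfst z = pfst x" "label c z = v" unfolding QP by (elim exE conjE)
      then show "v \<in> anc w" using label_in_anc[OF c, of z] by (simp add: w_def)
    qed
    have "eval {i. X i} (dec e) [D] i \<longleftrightarrow> kid D i \<in> anc w" if D: "pfst D = n" for D i
    proof
      assume "eval {i. X i} (dec e) [D] i"
      then obtain s where "?Q (r n) (psnd s) \<and> ?P (kid D (pfst s)) (psnd s)" "i = pfst s"
        unfolding e p[rule_format] D by (elim exE conjE) simp
      then show "kid D i \<in> anc w" unfolding in_anc by (intro exI[of _ "psnd s"]) simp
    next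
      assume kid: "kid D i \<in> anc w"
      then obtain y where y: "?Q (r n) y \<and> ?P (kid D i) y" unfolding in_anc by (elim exE)
      let ?R = "\<lambda>s. ?Q (r n) (psnd s) \<and> ?P (kid D (pfst s)) (psnd s)"
      have "?R (pair i y)" using y by simp
      then have R: "?R (LEAST s. ?R s)" by (rule LeastI)
      then have "kid D (pfst (LEAST s. ?R s)) \<in> anc w" unfolding in_anc by (rule exI)
      \<comment> \<open>Many elements can end the search, but they all show the same kid, since a
        path contains at most one kid of \<open>D\<close>.\<close>
      then have i: "i = pfst (LEAST s. ?R s)" by (rule kid_in_anc_unique[OF kid])
      show "eval {i. X i} (dec e) [D] i"
        unfolding e p[rule_format] D
        by (intro exI[of _ "LEAST s. ?R s"] conjI allI impI R i) (rule not_less_Least)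
    qed
    then show ?thesis
      using pw final_good[OF c, of "pfst (pfst x)"] by (intro exI[of _ w]) (simp add: w_def)
  qed
  then have "X \<in> readers e" unfolding readers_def by simp
  then show ?thesis ..
qed

theorem theorem4p1:
  shows "\<exists>(L :: language) (M :: nat struc).
    computable_language L \<and> is_struc L M \<and> countable (universe M) \<and>
    null_degrees (degree_spectrum L M) \<and> comeagre_degrees (degree_spectrum L M)"
proof (intro exI conjI)
  let ?c = "\<lambda>v. SOME i. kid v i \<notin> bad_nodes"
  let ?M = "tree_struc ?c"
  have "(\<lambda>r. case rels tree_language r of None \<Rightarrow> 0 | Some k \<Rightarrow> Suc k) = (\<lambda>r. if r = 0 then 3 else 2)"
    by (auto simp: tree_language_def)
  moreover have "recursive_in {} (\<lambda>r. if r = 0 then 3 else 2)" by (intro rec_intros)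
  ultimately show "computable_language tree_language"
    unfolding computable_language_def using rc_const[of "{}" 0] by (simp add: tree_language_def)
  show "is_struc tree_language ?M"
    by (simp add: is_struc_def tree_language_def tree_struc_def)
  show "countable (universe ?M)" by simp
  \<comment> \<open>Membership in the spectrum concerns degrees; by transitivity of reducibility it
    passes to the oracle itself.\<close>
  have in_spectrum: "X \<in> reals_of (degree_spectrum tree_language ?M) \<longleftrightarrow>
      (\<exists>N :: nat struc. is_struc tree_language N \<and> isomorphic tree_language ?M N \<and>
        turing_le (atomic_diagram tree_language N) {i. X i})" for X
  proof -
    have "turing_le B {i. X i}" if "turing_degree {i. X i} = turing_degree A" "turing_le B A" for A B
    proof -
      have "(A, {i. X i}) \<in> turing_equiv"
        using that(1)[symmetric] eq_equiv_class[OF _ equiv_turing_equiv] unfolding turing_degree_def by blast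
      then have "turing_le A {i. X i}" by (simp add: turing_equiv_def)
      with that(2) show ?thesis by (rule turing_le_trans)
    qed
    then have *: "turing_degree {i. X i} = turing_degree A \<Longrightarrow> turing_le B A \<Longrightarrow> turing_le B {i. X i}"
      for A B .
    show ?thesis
      unfolding reals_of_def degree_spectrum_def mem_Collect_eq
    proof (intro iffI; elim exE conjE)
      fix A and N :: "nat struc"
      assume "turing_degree {i. X i} = turing_degree A" "turing_le (atomic_diagram tree_language N) A"
        "is_struc tree_language N" "isomorphic tree_language ?M N"
      then show "\<exists>N :: nat struc. is_struc tree_language N \<and> isomorphic tree_language ?M N \<and>
          turing_le (atomic_diagram tree_language N) {i. X i}"
        using * by (intro exI[of _ N] conjI) assumption+
    next
      fix N :: "nat struc"
      assume "is_struc tree_language N" "isomorphic tree_language ?M N"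
        "turing_le (atomic_diagram tree_language N) {i. X i}"
      then show "\<exists>A. turing_degree {i. X i} = turing_degree A \<and>
          (\<exists>N :: nat struc. is_struc tree_language N \<and> isomorphic tree_language ?M N \<and>
            turing_le (atomic_diagram tree_language N) A)"
        by (intro exI[of _ "{i. X i}"] exI[of _ N] conjI refl)
    qed
  qed
  have "reals_of (degree_spectrum tree_language ?M) \<subseteq> (\<Union>e. readers e)"
  proof
    fix X assume "X \<in> reals_of (degree_spectrum tree_language ?M)"
    then obtain N :: "nat struc" where "isomorphic tree_language ?M N"
      "turing_le (atomic_diagram tree_language N) {i. X i}"
      unfolding in_spectrum by (elim exE conjE)
    from reader_of_copy[OF escapes_good_choice this] show "X \<in> (\<Union>e. readers e)" by simp
  qed
  moreover have "readers e \<in> null_sets fair_coin_measure" for e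
    using null_readers[of e] sets_readers[of e] by (simp add: null_sets_def coin.emeasure_eq_measure)
  \<comment> \<open>There are countably many programs. The completion makes the spectrum null as a
    subset, with no claim that it is measurable.\<close>
  then have "(\<Union>e. readers e) \<in> null_sets (completion fair_coin_measure)"
    by (intro null_sets_completionI null_sets_UN) auto
  ultimately show "null_degrees (degree_spectrum tree_language ?M)"
    unfolding null_degrees_def by (rule null_sets_completion_subset)
  have "generic \<subseteq> reals_of (degree_spectrum tree_language ?M)"
  proof
    fix X assume X: "X \<in> generic"
    then have "isomorphic tree_language ?M (tree_struc (choice_of X))"
      by (intro tree_struc_isomorphic escapes_good_choice) (simp add: generic_def)
    moreover have "is_struc tree_language (tree_struc (choice_of X))"
      by (simp add: is_struc_def tree_language_def tree_struc_def)
    ultimately show "X \<in> reals_of (degree_spectrum tree_language ?M)"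
      unfolding in_spectrum using diagram_tree_struc_le[OF X]
      by (intro exI[of _ "tree_struc (choice_of X)"] conjI)
  qed
  then show "comeagre_degrees (degree_spectrum tree_language ?M)"
    using meagre_not_generic unfolding comeagre_degrees_def meagre_def
    by (meson Compl_subset_Compl_iff order.trans)
qed

end
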